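(* Let $\phi,\psi$ be two centered Gaussian random variables valued in a separable Banach space $(V,\|\cdot\|)$. Let $f:V\to\mathbb R$ be a continuously twice Fréchet-differentiable functional with bounded first and second order derivatives. Assume that there exist a subset $\mathcal H$ of bounded $(0,2)$-tensors (bounded bilinear forms) on $V$ and a constant $c$ such that $D^2f\in\mathcal H$ (that is, $D^2f(x)\in\mathcal H$ for all $x\in V$), and for all $H\in\mathcal H$ $$\mathbb E[H(\phi,\phi)]\le\mathbb E[H(\psi,\psi)]+c.$$ Then $$\mathbb E[f(\psi)]\le\mathbb E[f(\phi)]+\frac c2 .$$
   Formalization: The printed conclusion is false (V=ℝ, φ=0, ψ~N(0,1), f(x)=√(1+x²), H the nonnegative forms, c=0); φ and ψ are exchanged in the conclusion, so what is proved is E[f(φ)] ≤ E[f(ψ)] + c/2. *)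

theory Defs
  imports "HOL-Probability.Probability"
begin

text \<open>
  A centered Gaussian measure on the real line with standard deviation \<open>\<sigma>\<close>. The degenerate case
  \<open>\<sigma> = 0\<close> is the Dirac mass at the origin; it has to be included because a Gaussian variable in a
  Banach space need not charge every direction.
\<close>
definition centered_normal :: "real \<Rightarrow> real measure" where
  "centered_normal \<sigma> =
     (if \<sigma> = 0 then return borel 0 else density lborel (\<lambda>x. ennreal (normal_density 0 \<sigma> x)))"

definition centered_gaussian ::
    "'a measure \<Rightarrow> ('a \<Rightarrow> 'v::{banach, second_countable_topology}) \<Rightarrow> bool" where
  "centered_gaussian M X \<longleftrightarrow>
     X \<in> borel_measurable M \<and>
     (\<forall>l :: 'v \<Rightarrow>\<^sub>L real. \<exists>\<sigma>\<ge>0. distr M borel (\<lambda>\<omega>. blinfun_apply l (X \<omega>)) = centered_normal \<sigma>)"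

text \<open>
  Bounded bilinear forms on \<open>'v\<close> are represented, as usual for second derivatives, by
  bounded linear maps from \<open>'v\<close> into the dual of \<open>'v\<close>; this identification is isometric.
\<close>
type_synonym 'v bilinear_form = "'v \<Rightarrow>\<^sub>L 'v \<Rightarrow>\<^sub>L real"

abbreviation form_apply :: "'v::real_normed_vector bilinear_form \<Rightarrow> 'v \<Rightarrow> 'v \<Rightarrow> real" where
  "form_apply B u v \<equiv> blinfun_apply (blinfun_apply B u) v"

end

theory Submission
  imports Defs
begin

text \<open>
  Let \<open>\<mu>\<close> and \<open>\<nu>\<close> be the laws of \<open>\<phi>\<close> and \<open>\<psi>\<close>, and put
  \<open>g s = E f (\<surd>(1 - s) Y + \<surd>s X)\<close> with independent \<open>X \<sim> \<mu>\<close>, \<open>Y \<sim> \<nu>\<close>. By stability of Gaussian laws,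
  passing from \<open>g s\<close> to \<open>g (s + h)\<close> replaces an independent increment \<open>\<surd>h Y'\<close> by \<open>\<surd>h X'\<close> around the
  common point \<open>Z = \<surd>(1 - s - h) Y + \<surd>s X\<close>. Expanding \<open>f\<close> to second order at \<open>Z\<close>, the linear terms
  vanish, the quadratic terms differ by at most \<open>c h / 2\<close> (apply the hypothesis to \<open>D2f Z\<close>), and
  the remainder is \<open>o(h)\<close> by dominated convergence. So the upper right Dini derivative of the
  continuous function \<open>g\<close> is at most \<open>c / 2\<close>; no Gaussian integration by parts is needed.

  Domination requires \<open>E \<parallel>X\<parallel>\<^sup>2 < \<infinity>\<close>, which is Fernique's theorem. Both it and stability follow from the
  rotation invariance of \<open>\<mu> \<otimes> \<mu>\<close>, which is checked on one-dimensional projections.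
\<close>

section \<open>Hahn--Banach\<close>

text \<open>The bound by the norm also yields the lower bound \<open>- norm x\<close> through
  subadditivity. Infima of such functionals therefore exist, and a linear one among them is
  automatically bounded.\<close>

definition sublinear_contraction :: "('v::real_normed_vector \<Rightarrow> real) \<Rightarrow> bool" where
  "sublinear_contraction q \<longleftrightarrow>
     (\<forall>x. q x \<le> norm x) \<and> (\<forall>x y. q (x + y) \<le> q x + q y) \<and>
     (\<forall>c>0. \<forall>x. q (c *\<^sub>R x) \<le> c * q x)"

lemma sublinear_contractionD:
  assumes "sublinear_contraction q"
  shows "q x \<le> norm x" "q (x + y) \<le> q x + q y" "c > 0 \<Longrightarrow> q (c *\<^sub>R x) = c * q x"
    "q 0 = 0" "- norm x \<le> q x"
proof -
  have le: "q (c *\<^sub>R x) \<le> c * q x" if "c > 0" for c x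
    using assms that by (auto simp: sublinear_contraction_def)
  have add: "q (x + y) \<le> q x + q y" for x y
    using assms by (auto simp: sublinear_contraction_def)
  have nrm: "q x \<le> norm x" for x
    using assms by (auto simp: sublinear_contraction_def)
  show "q x \<le> norm x" "q (x + y) \<le> q x + q y" by (fact nrm add)+
  show "q (c *\<^sub>R x) = c * q x" if "c > 0"
  proof (rule antisym[OF le[OF that]])
    have "q ((1 / c) *\<^sub>R (c *\<^sub>R x)) \<le> (1 / c) * q (c *\<^sub>R x)"
      using that by (intro le) auto
    then show "c * q x \<le> q (c *\<^sub>R x)"
      using that by (simp add: field_simps)
  qed
  show 0: "q 0 = 0"
    using add[of 0 0] nrm[of 0] by simp
  show "- norm x \<le> q x"
    using add[of x "- x"] nrm[of "- x"] 0 by simp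
qed

lemma sublinear_contraction_norm: "sublinear_contraction norm"
  by (simp add: sublinear_contraction_def norm_triangle_ineq)

text \<open>Take \<open>p y\<close> to be the infimum over t >= 0 of
  \<open>q (y + t *\<^sub>R x) - t * q x\<close>. The value t = 0 gives the first bound and t = 1
  the second. If \<open>q\<close> cannot be lowered, then \<open>p = q\<close>, and the second bound
  says that \<open>q\<close> is superadditive.\<close>

lemma sublinear_contraction_lower:
  assumes q: "sublinear_contraction q"
  obtains p where "sublinear_contraction p" "\<And>y. p y \<le> q y" "\<And>y. p y \<le> q (y + x) - q x"
proof
  note D = sublinear_contractionD[OF q]
  define r where "r y t = q (y + t *\<^sub>R x) - t * q x" for y t
  define p where "p y = (INF t\<in>{0..}. r y t)" for y
  \<comment> \<open>This keeps the infimum finite: t x is the sum of y + t x and -y, so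
    subadditivity and homogeneity bound \<open>r y t\<close> below uniformly in t.\<close>
  have "- q (- y) \<le> r y t" if "t \<ge> 0" for y t
    using D(2)[of "y + t *\<^sub>R x" "- y"] D(3)[of t x] D(4) that
    by (cases "t = 0") (auto simp: r_def)
  then have bdd: "bdd_below (r y ` {0..})" for y
    by (auto intro!: bdd_belowI2)
  have p_le: "p y \<le> r y t" if "t \<ge> 0" for y t
    unfolding p_def using that by (intro cINF_lower[OF bdd]) auto
  have p_ge: "m \<le> p y" if "\<And>t. t \<ge> 0 \<Longrightarrow> m \<le> r y t" for m y
    unfolding p_def using that by (intro cINF_greatest) auto
  show pq: "p y \<le> q y" "p y \<le> q (y + x) - q x" for y
    using p_le[of 0 y] p_le[of 1 y] by (auto simp: r_def)
  have "p (y + z) \<le> p y + p z" for y z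
  proof -
    \<comment> \<open>Parameters t and u for the two summands are merged into the parameter t + u
      for the sum.\<close>
    have "p (y + z) \<le> r y t + r z u" if "t \<ge> 0" "u \<ge> 0" for t u
      using p_le[of "t + u" "y + z"] D(2)[of "y + t *\<^sub>R x" "z + u *\<^sub>R x"] that
      by (simp add: r_def algebra_simps)
    then have "p (y + z) - r z u \<le> p y" if "u \<ge> 0" for u
      using that by (intro p_ge) (simp add: algebra_simps)
    then have "p (y + z) - p y \<le> p z"
      by (intro p_ge) (simp add: algebra_simps)
    then show ?thesis by simp
  qed
  moreover have "p (c *\<^sub>R y) \<le> c * p y" if "c > 0" for c y
  proof -
    have "p (c *\<^sub>R y) \<le> c * r y t" if "t \<ge> 0" for t
    proof -
      have "p (c *\<^sub>R y) \<le> r (c *\<^sub>R y) (c * t)"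
        using \<open>c > 0\<close> that by (intro p_le) simp
      also have "\<dots> = c * r y t"
        using D(3)[OF \<open>c > 0\<close>, of "y + t *\<^sub>R x"] by (simp add: r_def algebra_simps)
      finally show ?thesis .
    qed
    then have "p (c *\<^sub>R y) / c \<le> p y"
      using that by (intro p_ge) (simp add: field_simps)
    then show ?thesis using that by (simp add: field_simps)
  qed
  moreover have "p y \<le> norm y" for y
    using pq(1)[of y] D(1)[of y] by linarith
  ultimately show "sublinear_contraction p"
    by (simp add: sublinear_contraction_def)
qed

text \<open>
  Below every sublinear functional there is a minimal one (Zorn), and a minimal one is superadditive
  by the previous lemma, hence linear.
\<close>
lemma exists_functional_below:
  fixes q :: "'v::real_normed_vector \<Rightarrow> real"
  assumes q: "sublinear_contraction q"
  obtains l :: "'v \<Rightarrow>\<^sub>L real" where "\<And>y. l y \<le> q y"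
proof -
  define A where "A = {p :: 'v \<Rightarrow> real. sublinear_contraction p \<and> (\<forall>y. p y \<le> q y)}"
  \<comment> \<open>The order is reversed, so that the maximal element delivered by Zorn's lemma is
    a pointwise minimal functional.\<close>
  define P where "P p p' \<longleftrightarrow> (\<forall>y. p' y \<le> p y)" for p p' :: "'v \<Rightarrow> real"
  have "\<exists>m\<in>A. \<forall>a\<in>A. P m a \<longrightarrow> a = m"
  proof (rule predicate_Zorn)
    show "partial_order_on A (relation_of P A)"
      by (rule partial_order_on_relation_ofI) (auto simp: P_def fun_eq_iff intro: order_trans antisym)
  next
    fix C assume C: "C \<in> Chains (relation_of P A)"
    then have CA: "C \<subseteq> A"
      by (auto simp: Chains_def relation_of_def)
    show "\<exists>u\<in>A. \<forall>a\<in>C. P a u"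
    proof (cases "C = {}")
      case True
      then show ?thesis using q by (auto simp: A_def)
    next
      case False
      define u where "u y = (INF p\<in>C. p y)" for y
      have sub: "sublinear_contraction p" if "p \<in> C" for p
        using CA that by (auto simp: A_def)
      have bdd: "bdd_below ((\<lambda>p. p y) ` C)" for y
        using sublinear_contractionD(5)[OF sub] by (auto intro!: bdd_belowI2)
      have u_le: "u y \<le> p y" if "p \<in> C" for p y
        unfolding u_def using that by (intro cINF_lower[OF bdd]) auto
      have u_ge: "m \<le> u y" if "\<And>p. p \<in> C \<Longrightarrow> m \<le> p y" for m y
        unfolding u_def using that False by (intro cINF_greatest) auto
      obtain p0 where p0: "p0 \<in> C" using False by auto
      have uq: "u y \<le> q y" for y
        using u_le[OF p0] CA p0 by (auto simp: A_def intro: order_trans)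
      have "u (y + z) \<le> u y + u z" for y z
      proof -
        have "u (y + z) \<le> p y + p' z" if "p \<in> C" "p' \<in> C" for p p'
        proof -
          \<comment> \<open>Comparability in the chain lets one member \<open>r\<close> serve at
            both points; without it the infimum of subadditive functions need not be
            subadditive.\<close>
          have "P p p' \<or> P p' p"
            using C that by (auto simp: Chains_def relation_of_def)
          then have "\<exists>r\<in>C. r y \<le> p y \<and> r z \<le> p' z"
            using that by (auto simp: P_def)
          then obtain r where r: "r \<in> C" "r y \<le> p y" "r z \<le> p' z"
            by blast
          have "u (y + z) \<le> r (y + z)" using r by (intro u_le)
          also have "\<dots> \<le> r y + r z" using sub r by (intro sublinear_contractionD)
          finally show ?thesis using r by simp
        qed
        then have "u (y + z) - p' z \<le> u y" if "p' \<in> C" for p'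
          using that by (intro u_ge) (simp add: algebra_simps)
        then have "u (y + z) - u y \<le> u z"
          by (intro u_ge) (simp add: algebra_simps)
        then show ?thesis by simp
      qed
      moreover have "u (c *\<^sub>R y) \<le> c * u y" if "c > 0" for c y
      proof -
        have "u (c *\<^sub>R y) / c \<le> u y"
        proof (rule u_ge)
          fix p assume p: "p \<in> C"
          show "u (c *\<^sub>R y) / c \<le> p y"
            using u_le[OF p, of "c *\<^sub>R y"] sublinear_contractionD(3)[OF sub[OF p] that, of y] that
            by (simp add: field_simps)
        qed
        then show ?thesis using that by (simp add: field_simps)
      qed
      moreover have "u y \<le> norm y" for y
        using uq[of y] sublinear_contractionD(1)[OF q, of y] by linarith
      ultimately have "u \<in> A"
        using uq by (simp add: A_def sublinear_contraction_def)
      then show ?thesis using u_le by (auto simp: P_def)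
    qed
  qed
  then obtain m where "m \<in> A" and Pm: "\<And>a. a \<in> A \<Longrightarrow> P m a \<Longrightarrow> a = m"
    by blast
  then have m: "sublinear_contraction m" "\<And>y. m y \<le> q y"
    by (auto simp: A_def)
  have minimal: "a = m" if "sublinear_contraction a" "\<And>y. a y \<le> m y" for a
  proof (rule Pm)
    have "a y \<le> q y" for y
      using that(2)[of y] m(2)[of y] by simp
    then show "a \<in> A" using that by (simp add: A_def)
    show "P m a" using that by (simp add: P_def)
  qed
  note D = sublinear_contractionD[OF m(1)]
  have add: "m (x + y) = m x + m y" for x y
  proof -
    obtain p where "sublinear_contraction p" "\<And>y. p y \<le> m y" "\<And>y. p y \<le> m (y + x) - m x"
      using sublinear_contraction_lower[OF m(1), of x] by blast
    then have "m y \<le> m (y + x) - m x"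
      using minimal by metis
    then show ?thesis using D(2)[of x y] by (simp add: add.commute)
  qed
  have neg: "m (- x) = - m x" for x
    using add[of x "- x"] D(4) by simp
  have "m (c *\<^sub>R x) = c * m x" for c x
  proof -
    consider "c > 0" | "c = 0" | "- c > 0" by linarith
    then show ?thesis
    proof cases
      case 3
      then have "m ((- c) *\<^sub>R x) = (- c) * m x" by (rule D(3))
      then show ?thesis using neg[of "c *\<^sub>R x"] by simp
    qed (use D in auto)
  qed
  then have "bounded_linear m"
    using add D(1) D(5)[THEN le_imp_neg_le]
    by (intro bounded_linear_intro[where K = 1]) (auto simp: abs_le_iff)
  then show ?thesis
    using that[of "Blinfun m"] m(2) by (simp add: bounded_linear_Blinfun_apply)
qed

text \<open>Lower the norm in the direction x - y. The result is at most
  \<open>- norm (x - y)\<close> at the point -(x - y), so every linear functional below it is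
  strictly negative there.\<close>

lemma functional_separates_points:
  fixes x y :: "'v::real_normed_vector"
  assumes "x \<noteq> y"
  obtains l :: "'v \<Rightarrow>\<^sub>L real" where "l x \<noteq> l y"
proof -
  obtain q where q: "sublinear_contraction q" "\<And>z. q z \<le> norm (z + (x - y)) - norm (x - y)"
    by (rule sublinear_contraction_lower[OF sublinear_contraction_norm, of "x - y"]) (rule that)
  obtain l :: "'v \<Rightarrow>\<^sub>L real" where l: "\<And>z. l z \<le> q z"
    by (rule exists_functional_below[OF q(1)]) (rule that)
  have "0 < norm (x - y)" using assms by simp
  have "l (- (x - y)) < 0"
    using l[of "- (x - y)"] q(2)[of "- (x - y)"] \<open>0 < norm (x - y)\<close>
    unfolding left_minus norm_zero by linarith
  then have "l x \<noteq> l y"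
    by (simp add: blinfun.diff_right)
  then show ?thesis by (rule that)
qed

section \<open>Measures determined by one-dimensional projections\<close>

text \<open>The phase makes one constructor cover sines, cosines and, with \<open>l = 0\<close>,
  constants. Each generator depends on x only through one functional, which is what ties these
  functions to one-dimensional projections.\<close>

inductive_set trig_polynomials :: "('v::real_normed_vector \<Rightarrow> real) set" where
  wave: "(\<lambda>x. c * cos (blinfun_apply l x + \<theta>)) \<in> trig_polynomials"
| add: "p \<in> trig_polynomials \<Longrightarrow> q \<in> trig_polynomials \<Longrightarrow> (\<lambda>x. p x + q x) \<in> trig_polynomials"

lemma trig_polynomials_const: "(\<lambda>_. c) \<in> trig_polynomials"
  using trig_polynomials.wave[of c 0 0] by simp

text \<open>The product-to-sum formula turns a product of two waves into waves along
  \<open>l - l'\<close> and \<open>l + l'\<close>. This is the algebra property required by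
  Stone--Weierstrass.\<close>

lemma trig_polynomials_mult:
  assumes "p \<in> trig_polynomials" "q \<in> trig_polynomials"
  shows "(\<lambda>x. p x * q x) \<in> trig_polynomials"
  using assms
proof induction
  case (wave c l \<theta>)
  from \<open>q \<in> trig_polynomials\<close> show ?case
  proof induction
    case (wave c' l' \<theta>')
    have "c * cos (l x + \<theta>) * (c' * cos (l' x + \<theta>')) =
        c * c' / 2 * cos ((l - l') x + (\<theta> - \<theta>')) + c * c' / 2 * cos ((l + l') x + (\<theta> + \<theta>'))" for x
    proof -
      have "(l - l') x + (\<theta> - \<theta>') = (l x + \<theta>) - (l' x + \<theta>')"
        "(l + l') x + (\<theta> + \<theta>') = (l x + \<theta>) + (l' x + \<theta>')"
        by (simp_all add: blinfun.diff_left blinfun.add_left)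
      then show ?thesis
        by (simp only: cos_diff cos_add) (simp add: algebra_simps)
    qed
    then show ?case
      by (simp only:) (intro trig_polynomials.intros)
  next
    case (add p q)
    then show ?case
      using trig_polynomials.add[OF add.IH] by (simp add: distrib_left)
  qed
next
  case (add p p')
  then show ?case
    using trig_polynomials.add[of "\<lambda>x. p x * q x" "\<lambda>x. p' x * q x"] by (simp add: distrib_right)
qed

lemma trig_polynomials_compose:
  assumes "real_polynomial_function h" "p \<in> trig_polynomials"
  shows "(\<lambda>x. h (p x)) \<in> trig_polynomials"
  using assms(1)
proof induction
  case (linear h)
  then have "h y = h 1 * y" for y
    using linear_simps(5)[OF linear, of y 1] by (simp add: mult.commute)
  then have "(\<lambda>x. h (p x)) = (\<lambda>x. h 1 * p x)" by metis
  then show ?case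
    using trig_polynomials_mult[OF trig_polynomials_const assms(2)] by simp
next
  case (const c)
  show ?case by (rule trig_polynomials_const)
next
  case (add h k)
  then show ?case by (intro trig_polynomials.add)
next
  case (mult h k)
  then show ?case by (intro trig_polynomials_mult)
qed

lemma trig_polynomials_continuous:
  assumes "p \<in> trig_polynomials"
  shows "continuous_on S p"
  using assms by induction (auto intro!: continuous_intros)

lemma trig_polynomials_bounded:
  assumes "p \<in> trig_polynomials"
  shows "\<exists>B. \<forall>x. \<bar>p x\<bar> \<le> B"
  using assms
proof induction
  case (wave c l \<theta>)
  have "\<bar>c * cos (l x + \<theta>)\<bar> \<le> \<bar>c\<bar>" for x
    by (simp add: abs_mult mult_left_le)
  then show ?case by blast
next
  case (add p q)
  then obtain B C where "\<And>x. \<bar>p x\<bar> \<le> B" "\<And>x. \<bar>q x\<bar> \<le> C" by blast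
  then have "\<bar>p x + q x\<bar> \<le> B + C" for x
    using abs_triangle_ineq[of "p x" "q x"] by (smt (verit))
  then show ?case by blast
qed

section \<open>Borel probability measures, tightness and uniqueness\<close>

locale borel_prob_space = prob_space \<mu> for \<mu> :: "'v::topological_space measure" +
  assumes sets_eq_borel [simp, measurable_cong]: "sets \<mu> = sets borel"
begin

lemma space_eq_UNIV [simp]: "space \<mu> = UNIV"
  using sets_eq_imp_space_eq[OF sets_eq_borel] by simp

lemma integrable_continuous_bounded:
  fixes g :: "'v \<Rightarrow> 'b::{banach, second_countable_topology}"
  assumes "continuous_on UNIV g" "\<And>x. norm (g x) \<le> B"
  shows "integrable \<mu> g"
proof (rule integrable_const_bound)
  show "g \<in> borel_measurable \<mu>"
    using borel_measurable_continuous_onI[OF assms(1)] measurable_cong_sets[OF sets_eq_borel refl] by blast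
qed (use assms in auto)

end

text \<open>Ulam's theorem: a finite Borel measure on a Polish space is inner regular with respect
  to compact sets, applied here to the whole space.\<close>

lemma borel_prob_space_tight:
  fixes \<mu> :: "'v::{second_countable_topology, complete_space} measure"
  assumes "borel_prob_space \<mu>" "e > 0"
  obtains K where "compact K" "measure \<mu> (- K) < e"
proof -
  interpret borel_prob_space \<mu> by fact
  have "emeasure \<mu> UNIV = (SUP K\<in>{K. K \<subseteq> UNIV \<and> compact K}. emeasure \<mu> K)"
    using inner_regular[of \<mu> UNIV] emeasure_finite by simp
  moreover have "emeasure \<mu> UNIV = 1"
    using emeasure_space_1 by simp
  moreover have "ennreal (1 - e) < 1"
    using \<open>e > 0\<close> by (simp add: ennreal_less_one_iff)
  ultimately have "ennreal (1 - e) < (SUP K\<in>{K. K \<subseteq> UNIV \<and> compact K}. emeasure \<mu> K)"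
    by simp
  then obtain K where K: "compact K" "ennreal (1 - e) < emeasure \<mu> K"
    by (auto simp: less_SUP_iff)
  then have "1 - e < measure \<mu> K"
    unfolding emeasure_eq_measure by (metis ennreal_leI not_le)
  moreover have "measure \<mu> (- K) = 1 - measure \<mu> K"
    using prob_compl[of K] K(1) by (simp add: Compl_eq_Diff_UNIV borel_compact)
  ultimately show ?thesis
    using K(1) that by simp
qed

text \<open>
  Stone--Weierstrass only controls the approximation on a compact set; composing with a polynomial
  close to the truncation to \<open>[-1, 1]\<close> makes it bounded everywhere.
\<close>
lemma trig_polynomials_approx:
  fixes g :: "'v::real_normed_vector \<Rightarrow> real"
  assumes K: "compact K" and g: "continuous_on UNIV g" "\<And>x. \<bar>g x\<bar> \<le> 1" and "e > 0"
  obtains p where "p \<in> trig_polynomials" "\<And>x. \<bar>p x\<bar> \<le> 1 + e" "\<And>x. x \<in> K \<Longrightarrow> \<bar>g x - p x\<bar> \<le> e"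
proof -
  interpret function_ring_on trig_polynomials K
  proof
    fix x y :: 'v assume "x \<noteq> y"
    then obtain l :: "'v \<Rightarrow>\<^sub>L real" where l: "l x \<noteq> l y"
      by (rule functional_separates_points)
    define d where "d = l x - l y"
    have "d \<noteq> 0" using l by (simp add: d_def)
    \<comment> \<open>The scaling makes the two arguments differ by exactly pi, so the cosine with
      phase \<open>- l' y\<close> is -1 at x and 1 at y.\<close>
    define l' where "l' = (pi / d) *\<^sub>R l"
    have "l' x + - l' y = pi / d * d"
      by (simp add: l'_def d_def blinfun.scaleR_left right_diff_distrib)
    then have "l' x + - l' y = pi"
      using \<open>d \<noteq> 0\<close> by simp
    then have "1 * cos (l' x + - l' y) \<noteq> 1 * cos (l' y + - l' y)"
      by (simp only:) simp
    then show "\<exists>f\<in>trig_polynomials. f x \<noteq> f y"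
      by (intro bexI[where x = "\<lambda>z. 1 * cos (l' z + - l' y)"] trig_polynomials.wave)
  qed (fact K, erule trig_polynomials_continuous, erule (1) trig_polynomials.add,
      erule (1) trig_polynomials_mult, rule trig_polynomials_const)
  obtain r where r: "r \<in> trig_polynomials" "\<And>x. x \<in> K \<Longrightarrow> \<bar>g x - r x\<bar> < e / 2"
    using Stone_Weierstrass_basic[OF continuous_on_subset[OF g(1) subset_UNIV], of "e / 2"] \<open>e > 0\<close>
    by auto
  obtain B where B: "\<And>x. \<bar>r x\<bar> \<le> B"
    using trig_polynomials_bounded[OF r(1)] by blast
  define h where "h t = max (- 1) (min 1 t)" for t :: real
  have "continuous_on {-B..B} h"
    unfolding h_def by (intro continuous_intros)
  then obtain q where q: "real_polynomial_function q" "\<And>t. t \<in> {-B..B} \<Longrightarrow> \<bar>h t - q t\<bar> < e / 2"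
    using Stone_Weierstrass_real_polynomial_function[of "{-B..B}" h "e / 2"] \<open>e > 0\<close> by auto
  have qr: "\<bar>h (r x) - q (r x)\<bar> < e / 2" for x
    using B[of x] by (intro q(2)) (auto simp: abs_le_iff)
  show ?thesis
  proof
    show "(\<lambda>x. q (r x)) \<in> trig_polynomials"
      by (rule trig_polynomials_compose) fact+
    show "\<bar>q (r x)\<bar> \<le> 1 + e" for x
      using qr[of x] \<open>e > 0\<close> by (auto simp: h_def max_def min_def abs_if split: if_splits)
    show "\<bar>g x - q (r x)\<bar> \<le> e" if "x \<in> K" for x
    proof -
      \<comment> \<open>Truncation fixes the values of \<open>g\<close> and is 1-Lipschitz, so the
        two errors of size e / 2 simply add up.\<close>
      have "h (g x) = g x" using g(2)[of x] by (auto simp: h_def)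
      moreover have "\<bar>h (g x) - h (r x)\<bar> \<le> \<bar>g x - r x\<bar>"
        by (auto simp: h_def max_def min_def abs_if)
      ultimately show ?thesis
        using qr[of x] r(2)[OF that] by linarith
    qed
  qed
qed

text \<open>Each wave is a function of the single number \<open>l x\<close>, so its integral is
  determined by the law of \<open>l\<close>. Sums follow by linearity.\<close>

lemma integral_trig_polynomials_eq:
  fixes \<mu> \<nu> :: "'v::{banach, second_countable_topology} measure"
  assumes "borel_prob_space \<mu>" "borel_prob_space \<nu>"
    and eq: "\<And>l :: 'v \<Rightarrow>\<^sub>L real. distr \<mu> borel l = distr \<nu> borel l"
    and "p \<in> trig_polynomials"
  shows "integral\<^sup>L \<mu> p = integral\<^sup>L \<nu> p"
proof -
  interpret \<mu>: borel_prob_space \<mu> by fact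
  interpret \<nu>: borel_prob_space \<nu> by fact
  show ?thesis
    using assms(4)
  proof induction
    case (wave c l \<theta>)
    have [measurable]: "blinfun_apply l \<in> borel_measurable borel"
      by (intro borel_measurable_continuous_onI continuous_intros)
    have "integral\<^sup>L \<mu> (\<lambda>x. c * cos (l x + \<theta>)) = integral\<^sup>L (distr \<mu> borel l) (\<lambda>y. c * cos (y + \<theta>))"
      by (subst integral_distr) auto
    also have "\<dots> = integral\<^sup>L \<nu> (\<lambda>x. c * cos (l x + \<theta>))"
      unfolding eq by (subst integral_distr) auto
    finally show ?case .
  next
    case (add p q)
    have "integrable \<mu> p" "integrable \<mu> q" "integrable \<nu> p" "integrable \<nu> q"
      using add.hyps trig_polynomials_bounded trig_polynomials_continuous
      by (metis \<mu>.integrable_continuous_bounded \<nu>.integrable_continuous_bounded real_norm_def)+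
    then show ?case using add by simp
  qed
qed

text \<open>On \<open>K\<close> the integrands differ by at most e. Off \<open>K\<close> they differ
  by at most 2 + e <= 3 on a set of mass at most e, whence e + 3 e.\<close>

lemma (in borel_prob_space) integral_close:
  fixes g p :: "'v \<Rightarrow> real"
  assumes g: "continuous_on UNIV g" "\<And>x. \<bar>g x\<bar> \<le> 1" and p: "continuous_on UNIV p" "\<And>x. \<bar>p x\<bar> \<le> 1 + e"
    and K: "K \<in> sets borel" "measure \<mu> (- K) \<le> e" "\<And>x. x \<in> K \<Longrightarrow> \<bar>g x - p x\<bar> \<le> e" and "0 < e" "e \<le> 1"
  shows "\<bar>integral\<^sup>L \<mu> g - integral\<^sup>L \<mu> p\<bar> \<le> 4 * e"
proof -
  have int: "integrable \<mu> g" "integrable \<mu> p"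
    using integrable_continuous_bounded[of g 1] integrable_continuous_bounded[of p "1 + e"] g p
    by simp_all
  have K': "- K \<in> sets \<mu>" using K(1) by auto
  have "\<bar>integral\<^sup>L \<mu> g - integral\<^sup>L \<mu> p\<bar> = \<bar>\<integral>x. g x - p x \<partial>\<mu>\<bar>"
    using int by simp
  also have "\<dots> \<le> (\<integral>x. \<bar>g x - p x\<bar> \<partial>\<mu>)"
    by (rule integral_abs_bound)
  also have "\<dots> \<le> (\<integral>x. e + 3 * indicator (- K) x \<partial>\<mu>)"
  proof (rule integral_mono)
    show "integrable \<mu> (\<lambda>x. e + 3 * indicat_real (- K) x)"
      using K' by (intro Bochner_Integration.integrable_add integrable_const integrable_mult_right
          integrable_real_indicator) (auto simp: emeasure_eq_measure)
    show "\<bar>g x - p x\<bar> \<le> e + 3 * indicator (- K) x" for x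
      using g(2)[of x] p(2)[of x] K(3)[of x] \<open>0 < e\<close> \<open>e \<le> 1\<close> by (cases "x \<in> K") auto
  qed (use int in auto)
  also have "\<dots> = e + 3 * measure \<mu> (- K)"
    using K' prob_space by (subst Bochner_Integration.integral_add) (auto simp: emeasure_eq_measure)
  finally show ?thesis using K(2) by linarith
qed

text \<open>Tightness confines both measures, up to mass e, to one compact set, where trigonometric
  polynomials approximate any bounded continuous function. Integrals of such functions therefore
  agree. Continuous approximation of indicators gives agreement on closed sets, which form an
  intersection-stable generator of the Borel sets.\<close>

theorem borel_prob_space_eqI_functionals:
  fixes \<mu> \<nu> :: "'v::{banach, second_countable_topology} measure"
  assumes \<mu>: "borel_prob_space \<mu>" and \<nu>: "borel_prob_space \<nu>"
    and eq: "\<And>l :: 'v \<Rightarrow>\<^sub>L real. distr \<mu> borel l = distr \<nu> borel l"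
  shows "\<mu> = \<nu>"
proof -
  interpret \<mu>: borel_prob_space \<mu> by fact
  interpret \<nu>: borel_prob_space \<nu> by fact
  have cont_eq: "integral\<^sup>L \<mu> g = integral\<^sup>L \<nu> g"
    if g: "continuous_on UNIV g" "\<And>x. \<bar>g x\<bar> \<le> 1" for g :: "'v \<Rightarrow> real"
  proof -
    have bnd: "\<bar>integral\<^sup>L \<mu> g - integral\<^sup>L \<nu> g\<bar> \<le> 8 * e" if e: "0 < e" "e \<le> 1" for e
    proof -
      obtain K1 where K1: "compact K1" "measure \<mu> (- K1) < e"
        using borel_prob_space_tight[OF \<mu> e(1)] .
      obtain K2 where K2: "compact K2" "measure \<nu> (- K2) < e"
        using borel_prob_space_tight[OF \<nu> e(1)] .
      define K where "K = K1 \<union> K2"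
      have K: "compact K" unfolding K_def using K1 K2 by auto
      have "measure \<mu> (- K) \<le> measure \<mu> (- K1)" "measure \<nu> (- K) \<le> measure \<nu> (- K2)"
        using K1(1) K2(1) by (auto intro!: \<mu>.finite_measure_mono \<nu>.finite_measure_mono
            simp: K_def borel_closed borel_open open_Compl compact_imp_closed)
      then have mK: "measure \<mu> (- K) \<le> e" "measure \<nu> (- K) \<le> e"
        using K1 K2 by auto
      obtain p where p: "p \<in> trig_polynomials" "\<And>x. \<bar>p x\<bar> \<le> 1 + e"
        "\<And>x. x \<in> K \<Longrightarrow> \<bar>g x - p x\<bar> \<le> e"
        using trig_polynomials_approx[OF K g e(1)] by blast
      have "\<bar>integral\<^sup>L \<mu> g - integral\<^sup>L \<mu> p\<bar> \<le> 4 * e" "\<bar>integral\<^sup>L \<nu> g - integral\<^sup>L \<nu> p\<bar> \<le> 4 * e"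
        using g p e K mK trig_polynomials_continuous[OF p(1)] borel_compact[OF K]
        by (auto intro!: \<mu>.integral_close \<nu>.integral_close)
      moreover have "integral\<^sup>L \<mu> p = integral\<^sup>L \<nu> p"
        by (rule integral_trig_polynomials_eq[OF \<mu> \<nu> eq p(1)])
      ultimately show ?thesis by linarith
    qed
    have "\<bar>integral\<^sup>L \<mu> g - integral\<^sup>L \<nu> g\<bar> \<le> 0 + e" if "e > 0" for e
    proof -
      have "0 < min 1 (e / 8)" "min 1 (e / 8) \<le> 1" "8 * min 1 (e / 8) \<le> e"
        using that by auto
      then show ?thesis using bnd[of "min 1 (e / 8)"] by linarith
    qed
    then have "\<bar>integral\<^sup>L \<mu> g - integral\<^sup>L \<nu> g\<bar> \<le> 0"
      by (rule field_le_epsilon)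
    then show ?thesis by simp
  qed
  have closed_eq: "emeasure \<mu> F = emeasure \<nu> F" if F: "closed F" for F
  \<comment> \<open>The empty set is split off because \<open>infdist x {}\<close> is 0 by
    convention, so the functions \<open>g n\<close> below would be constantly 1 instead of tending
    to the indicator.\<close>
  proof (cases "F = {}")
    case False
    define g where "g n x = max 0 (1 - real n * infdist x F)" for n x
    have g: "continuous_on UNIV (g n)" "\<bar>g n x\<bar> \<le> 1" for n x
      unfolding g_def by (auto intro!: continuous_intros simp: infdist_nonneg)
    have lim: "(\<lambda>n. g n x) \<longlonglongrightarrow> indicator F x" for x
    proof (cases "x \<in> F")
      case True
      then show ?thesis by (simp add: g_def)
    next
      case nF: False
      then have pos: "infdist x F > 0"
        using infdist_pos_not_in_closed[OF F False] by simp
      obtain N where N: "real N * infdist x F > 1"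
        using reals_Archimedean3[OF pos] by blast
      have "g n x = 0" if "n \<ge> N" for n
      proof -
        have "real N * infdist x F \<le> real n * infdist x F"
          using that pos by (intro mult_right_mono) auto
        then show ?thesis using N by (simp add: g_def)
      qed
      then show ?thesis
        using nF by (intro tendsto_eventually) (auto simp: eventually_sequentially)
    qed
    have meas: "g n \<in> borel_measurable borel" for n
      using g(1) by (rule borel_measurable_continuous_onI)
    have F': "F \<in> sets borel" using F by simp
    have to_F: "(\<lambda>n. integral\<^sup>L \<rho> (g n)) \<longlonglongrightarrow> measure \<rho> F" if "borel_prob_space \<rho>" for \<rho>
    proof -
      interpret \<rho>: borel_prob_space \<rho> by fact
      have "(\<lambda>n. integral\<^sup>L \<rho> (g n)) \<longlonglongrightarrow> (\<integral>x. indicator F x \<partial>\<rho>)"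
      proof (rule integral_dominated_convergence[where w = "\<lambda>_. 1"])
        show "g n \<in> borel_measurable \<rho>" for n
          using meas[of n] by simp
        show "AE x in \<rho>. (\<lambda>n. g n x) \<longlonglongrightarrow> indicator F x"
          using lim by (rule AE_I2)
        show "AE x in \<rho>. norm (g n x) \<le> 1" for n
          using g(2) by (intro AE_I2) simp
      qed (use F' in simp_all)
      then show ?thesis using F' by simp
    qed
    have "measure \<mu> F = measure \<nu> F"
      using to_F[OF \<mu>, unfolded cont_eq[OF g]] to_F[OF \<nu>] by (rule LIMSEQ_unique)
    then show ?thesis
      by (simp add: \<mu>.emeasure_eq_measure \<nu>.emeasure_eq_measure)
  qed simp
  have sets: "sets borel = sigma_sets UNIV (Collect closed :: 'v set set)"
    unfolding borel_eq_closed by simp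
  show ?thesis
  proof (rule measure_eqI_generator_eq[where E = "Collect closed" and \<Omega> = UNIV and A = "\<lambda>_. UNIV"])
    show "Int_stable (Collect closed :: 'v set set)"
      by (auto simp: Int_stable_def)
    show "emeasure \<mu> UNIV \<noteq> \<infinity>" by (simp add: \<mu>.emeasure_eq_measure)
    show "emeasure \<mu> F = emeasure \<nu> F" if "F \<in> Collect closed" for F
      using that by (intro closed_eq) simp
  qed (simp_all add: sets)
qed

section \<open>Rotation invariance of Gaussian measures\<close>

lemma std_normal_distribution_square:
  "integrable std_normal_distribution (\<lambda>x. x\<^sup>2)" "(\<integral>x. x\<^sup>2 \<partial>std_normal_distribution) = 1"
  using integrable_std_normal_distribution_moment[of 2] std_normal_distribution_even_moments(1)[of 1]
  by (simp_all add: fact_numeral)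

lemma std_normal_distribution_mean:
  "integrable std_normal_distribution (\<lambda>x. x)" "(\<integral>x. x \<partial>std_normal_distribution) = 0"
  using integrable_std_normal_distribution_moment[of 1] integral_std_normal_distribution_moment_odd[of 1]
  by simp_all

text \<open>Writing every centered normal law as a scaled standard one treats the Dirac case and the
  density case alike. Moments and characteristic functions are then read off from the standard
  normal law.\<close>

lemma centered_normal_eq_distr:
  assumes "\<sigma> \<ge> 0"
  shows "centered_normal \<sigma> = distr std_normal_distribution borel (\<lambda>x. \<sigma> * x)"
proof -
  interpret N: real_distribution std_normal_distribution
    by (rule real_dist_normal_dist)
  show ?thesis
  proof (cases "\<sigma> = 0")
    case True
    then show ?thesis
      using N.distr_const[of 0 borel] by (simp add: centered_normal_def)
  next
    case False
    have "distributed std_normal_distribution lborel (\<lambda>x. x) std_normal_density"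
      by (simp add: distributed_def distr_id2)
    then have "distributed std_normal_distribution lborel (\<lambda>x. 0 + \<sigma> * x)
        (normal_density (0 + \<sigma> * 0) (\<bar>\<sigma>\<bar> * 1))"
      using False by (intro N.normal_density_affine) auto
    then have "distr std_normal_distribution lborel (\<lambda>x. \<sigma> * x) = density lborel (normal_density 0 \<sigma>)"
      using assms by (simp add: distributed_def)
    moreover have "distr std_normal_distribution lborel (\<lambda>x. \<sigma> * x) =
        distr std_normal_distribution borel (\<lambda>x. \<sigma> * x)"
      by (rule distr_cong) auto
    ultimately show ?thesis
      using False by (simp add: centered_normal_def)
  qed
qed

lemma integral_eq_of_distr_eq:
  fixes F :: "'c \<Rightarrow> 'd::{banach, second_countable_topology}"
  assumes "distr M N f = distr M' N g" "f \<in> measurable M N" "g \<in> measurable M' N"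
    and "F \<in> borel_measurable N"
  shows "integrable M (\<lambda>x. F (f x)) \<longleftrightarrow> integrable M' (\<lambda>x. F (g x))"
    and "(\<integral>x. F (f x) \<partial>M) = (\<integral>x. F (g x) \<partial>M')"
  using assms integrable_distr_eq integral_distr by metis+

locale gaussian_measure = borel_prob_space \<mu>
  for \<mu> :: "'v::{banach, second_countable_topology} measure" +
  assumes projections: "\<exists>\<sigma>\<ge>0. distr \<mu> borel (blinfun_apply l) = centered_normal \<sigma>"
begin

lemma measurable_functional [measurable]: "blinfun_apply (l :: 'v \<Rightarrow>\<^sub>L real) \<in> borel_measurable borel"
  by (intro borel_measurable_continuous_onI continuous_intros)

definition variance_of :: "('v \<Rightarrow>\<^sub>L real) \<Rightarrow> real" where
  "variance_of l = (\<integral>x. (l x)\<^sup>2 \<partial>\<mu>)"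

text \<open>Each projection is \<sigma> times a standard normal variable; its mean is 0, so its
  second moment \<sigma>^2 is its variance. The characteristic function is needed at frequency 1
  only, since frequency t is reached by scaling the functional by t.\<close>

lemma
  shows integrable_functional: "integrable \<mu> (blinfun_apply l)"
    and integral_functional: "(\<integral>x. l x \<partial>\<mu>) = 0"
    and integrable_functional_square: "integrable \<mu> (\<lambda>x. (l x)\<^sup>2)"
    and char_functional: "(CLINT x|\<mu>. iexp (l x)) = exp (- (variance_of l / 2))"
proof -
  obtain \<sigma> where "\<sigma> \<ge> 0" and \<sigma>: "distr \<mu> borel l = distr std_normal_distribution borel (\<lambda>x. \<sigma> * x)"
    using projections centered_normal_eq_distr by metis
  have l: "blinfun_apply l \<in> borel_measurable \<mu>"
    and m: "(\<lambda>x. \<sigma> * x) \<in> borel_measurable std_normal_distribution"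
    by simp_all
  note int = integral_eq_of_distr_eq[OF \<sigma> l m]
  show "integrable \<mu> (blinfun_apply l)"
    using int(1)[of "\<lambda>y. y"] integrable_mult_right[OF std_normal_distribution_mean(1), of \<sigma>] by simp
  show "(\<integral>x. l x \<partial>\<mu>) = 0"
    using int(2)[of "\<lambda>y. y"] std_normal_distribution_mean(2) by simp
  show "integrable \<mu> (\<lambda>x. (l x)\<^sup>2)"
    using int(1)[of "\<lambda>y. y\<^sup>2"] integrable_mult_right[OF std_normal_distribution_square(1), of "\<sigma>\<^sup>2"]
    by (simp add: power_mult_distrib)
  have "variance_of l = \<sigma>\<^sup>2"
    using int(2)[of "\<lambda>y. y\<^sup>2"] std_normal_distribution_square(2)
    by (simp add: power_mult_distrib variance_of_def)
  moreover have "(CLINT x|\<mu>. iexp (l x)) = char std_normal_distribution \<sigma>"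
    using int(2)[of iexp] by (simp add: char_def)
  ultimately show "(CLINT x|\<mu>. iexp (l x)) = exp (- (variance_of l / 2))"
    by (simp add: char_std_normal_distribution exp_of_real)
qed

sublocale pair: pair_prob_space \<mu> \<mu> ..

lemma borel_prob_space_pair: "borel_prob_space (\<mu> \<Otimes>\<^sub>M \<mu>)"
proof
  show "sets (\<mu> \<Otimes>\<^sub>M \<mu>) = sets borel"
    unfolding borel_prod[symmetric] by (intro sets_pair_measure_cong) simp_all
qed

text \<open>Independence factors the characteristic function. Only the sum of the two variances
  survives, and this is the quantity that rotations preserve.\<close>

lemma char_pair:
  fixes k l :: "'v \<Rightarrow>\<^sub>L real"
  shows "(CLINT p|\<mu> \<Otimes>\<^sub>M \<mu>. iexp (k (fst p) + l (snd p))) =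
     exp (- ((variance_of k + variance_of l) / 2))"
proof -
  interpret P: borel_prob_space "\<mu> \<Otimes>\<^sub>M \<mu>" by (rule borel_prob_space_pair)
  have "integrable (\<mu> \<Otimes>\<^sub>M \<mu>) (\<lambda>p. iexp (k (fst p) + l (snd p)))"
    by (rule P.integrable_continuous_bounded[where B = 1]) (auto intro!: continuous_intros)
  from pair.integral_fst'[OF this]
  have "(CLINT p|\<mu> \<Otimes>\<^sub>M \<mu>. iexp (k (fst p) + l (snd p))) = (CLINT x|\<mu>. CLINT y|\<mu>. iexp (k x) * iexp (l y))"
    by (simp add: exp_add[symmetric] distrib_left)
  also have "\<dots> = (CLINT x|\<mu>. iexp (k x)) * (CLINT y|\<mu>. iexp (l y))"
    by simp
  also have "\<dots> = of_real (exp (- (variance_of k / 2)) * exp (- (variance_of l / 2)))"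
    by (simp add: char_functional)
  also have "exp (- (variance_of k / 2)) * exp (- (variance_of l / 2)) =
      exp (- ((variance_of k + variance_of l) / 2))"
    by (simp add: exp_add[symmetric] add_divide_distrib)
  finally show ?thesis .
qed

text \<open>Pythagoras holds pointwise: (a u + b v)^2 + (b u - a v)^2 = (a^2 + b^2)(u^2 + v^2). The
  cross terms cancel before integration, so no covariances appear.\<close>

lemma variance_of_rotate:
  fixes a b :: real and k l :: "'v \<Rightarrow>\<^sub>L real"
  assumes "a\<^sup>2 + b\<^sup>2 = 1"
  shows "variance_of (a *\<^sub>R k + b *\<^sub>R l) + variance_of (b *\<^sub>R k - a *\<^sub>R l) = variance_of k + variance_of l"
proof -
  have "variance_of (a *\<^sub>R k + b *\<^sub>R l) + variance_of (b *\<^sub>R k - a *\<^sub>R l) =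
      (\<integral>x. ((a *\<^sub>R k + b *\<^sub>R l) x)\<^sup>2 + ((b *\<^sub>R k - a *\<^sub>R l) x)\<^sup>2 \<partial>\<mu>)"
    unfolding variance_of_def
    by (intro Bochner_Integration.integral_add[symmetric] integrable_functional_square)
  also have "\<dots> = (\<integral>x. (k x)\<^sup>2 + (l x)\<^sup>2 \<partial>\<mu>)"
  proof (rule Bochner_Integration.integral_cong[OF refl])
    fix x
    have "((a *\<^sub>R k + b *\<^sub>R l) x)\<^sup>2 + ((b *\<^sub>R k - a *\<^sub>R l) x)\<^sup>2 = (a\<^sup>2 + b\<^sup>2) * ((k x)\<^sup>2 + (l x)\<^sup>2)"
      by (simp add: blinfun.add_left blinfun.diff_left blinfun.scaleR_left power2_eq_square algebra_simps)
    then show "((a *\<^sub>R k + b *\<^sub>R l) x)\<^sup>2 + ((b *\<^sub>R k - a *\<^sub>R l) x)\<^sup>2 = (k x)\<^sup>2 + (l x)\<^sup>2"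
      using assms by simp
  qed
  also have "\<dots> = variance_of k + variance_of l"
    unfolding variance_of_def
    by (intro Bochner_Integration.integral_add integrable_functional_square)
  finally show ?thesis .
qed

text \<open>The map has the orthogonal matrix with rows (a, b) and (b, -a). A functional on the
  product splits into components k and l; composing it with the map replaces them by a k + b l and b
  k - a l. The characteristic function sees only the sum of variances, so it is unchanged, and
  projections determine the measure.\<close>

theorem rotation_invariant:
  fixes a b :: real
  assumes ab: "a\<^sup>2 + b\<^sup>2 = 1"
  shows "distr (\<mu> \<Otimes>\<^sub>M \<mu>) borel (\<lambda>(x, y). (a *\<^sub>R x + b *\<^sub>R y, b *\<^sub>R x - a *\<^sub>R y)) = \<mu> \<Otimes>\<^sub>M \<mu>"
    (is "distr _ _ ?R = _")
proof -
  interpret P: borel_prob_space "\<mu> \<Otimes>\<^sub>M \<mu>" by (rule borel_prob_space_pair)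
  have R [measurable]: "?R \<in> measurable (\<mu> \<Otimes>\<^sub>M \<mu>) borel"
  proof -
    have "?R \<in> measurable borel borel"
      unfolding case_prod_unfold by (intro borel_measurable_continuous_onI continuous_intros)
    then show ?thesis by (simp add: measurable_cong_sets[OF P.sets_eq_borel refl])
  qed
  have P': "borel_prob_space (distr (\<mu> \<Otimes>\<^sub>M \<mu>) borel ?R)"
    using pair.prob_space_distr[OF R] by (simp add: borel_prob_space_def borel_prob_space_axioms_def)
  interpret P': borel_prob_space "distr (\<mu> \<Otimes>\<^sub>M \<mu>) borel ?R" by (rule P')
  show ?thesis
  proof (rule borel_prob_space_eqI_functionals[OF P' borel_prob_space_pair], rule Levy_uniqueness)
    fix L :: "('v \<times> 'v) \<Rightarrow>\<^sub>L real"
    have L: "blinfun_apply L \<in> borel_measurable borel"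
      by (intro borel_measurable_continuous_onI continuous_intros)
    then have L': "blinfun_apply L \<in> borel_measurable (\<mu> \<Otimes>\<^sub>M \<mu>)"
      by (simp add: measurable_cong_sets[OF P.sets_eq_borel refl])
    show "real_distribution (distr (distr (\<mu> \<Otimes>\<^sub>M \<mu>) borel ?R) borel L)"
      by (rule P'.real_distribution_distr) (simp add: L)
    show "real_distribution (distr (\<mu> \<Otimes>\<^sub>M \<mu>) borel L)"
      by (rule pair.real_distribution_distr) (rule L')
    \<comment> \<open>\<open>k\<close> and \<open>l\<close> are the restrictions of \<open>L\<close>
      to the two coordinate axes.\<close>
    define k :: "'v \<Rightarrow>\<^sub>L real" where "k = Blinfun (\<lambda>x. L (x, 0))"
    define l :: "'v \<Rightarrow>\<^sub>L real" where "l = Blinfun (\<lambda>y. L (0, y))"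
    have "bounded_linear (\<lambda>x. L (x, 0))" "bounded_linear (\<lambda>y. L (0, y))"
      by (intro bounded_linear_compose[OF blinfun.bounded_linear_right]
          bounded_linear_Pair bounded_linear_ident bounded_linear_zero)+
    then have k: "k x = L (x, 0)" and l: "l y = L (0, y)" for x y
      by (simp_all add: k_def l_def bounded_linear_Blinfun_apply)
    have Lkl: "L (x, y) = k x + l y" for x y
      unfolding k l by (simp add: blinfun.add_right[symmetric])
    have id: "(\<lambda>x. x) \<in> borel_measurable (borel :: real measure)" by simp
    show "char (distr (distr (\<mu> \<Otimes>\<^sub>M \<mu>) borel ?R) borel L) = char (distr (\<mu> \<Otimes>\<^sub>M \<mu>) borel L)"
    proof
      fix t :: real
      let ?k = "t *\<^sub>R k" and ?l = "t *\<^sub>R l"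
      have "char (distr (distr (\<mu> \<Otimes>\<^sub>M \<mu>) borel ?R) borel L) t = (CLINT p|\<mu> \<Otimes>\<^sub>M \<mu>. iexp (t * L (?R p)))"
        unfolding char_def using L R by (simp add: integral_distr)
      also have "\<dots> = (CLINT p|\<mu> \<Otimes>\<^sub>M \<mu>. iexp ((a *\<^sub>R ?k + b *\<^sub>R ?l) (fst p) + (b *\<^sub>R ?k - a *\<^sub>R ?l) (snd p)))"
      proof -
        have "t * L (?R p) = (a *\<^sub>R ?k + b *\<^sub>R ?l) (fst p) + (b *\<^sub>R ?k - a *\<^sub>R ?l) (snd p)" for p
          by (simp add: case_prod_unfold Lkl blinfun.bilinear_simps algebra_simps)
        then show ?thesis by (simp only:)
      qed
      also have "\<dots> = exp (- ((variance_of ?k + variance_of ?l) / 2))"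
        unfolding char_pair variance_of_rotate[OF ab] ..
      also have "\<dots> = (CLINT p|\<mu> \<Otimes>\<^sub>M \<mu>. iexp (?k (fst p) + ?l (snd p)))"
        unfolding char_pair ..
      also have "\<dots> = (CLINT p|\<mu> \<Otimes>\<^sub>M \<mu>. iexp (t * L p))"
      proof -
        have "?k (fst p) + ?l (snd p) = t * L p" for p
          using Lkl[of "fst p" "snd p"] by (simp add: blinfun.bilinear_simps algebra_simps)
        then show ?thesis by (simp only:)
      qed
      also have "\<dots> = char (distr (\<mu> \<Otimes>\<^sub>M \<mu>) borel L) t"
        unfolding char_def using L' by (simp add: integral_distr)
      finally show "char (distr (distr (\<mu> \<Otimes>\<^sub>M \<mu>) borel ?R) borel L) t = char (distr (\<mu> \<Otimes>\<^sub>M \<mu>) borel L) t" .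
    qed
  qed
qed

end

section \<open>Fernique's moment bound\<close>

context gaussian_measure
begin

text \<open>Stability under independent combination: this is the first marginal of the rotated pair,
  hence the first marginal of the original pair.\<close>

lemma distr_linear_combination:
  fixes a b :: real
  assumes "a\<^sup>2 + b\<^sup>2 = 1"
  shows "distr (\<mu> \<Otimes>\<^sub>M \<mu>) borel (\<lambda>(x, y). a *\<^sub>R x + b *\<^sub>R y) = \<mu>"
proof -
  let ?R = "\<lambda>(x, y). (a *\<^sub>R x + b *\<^sub>R y, b *\<^sub>R x - a *\<^sub>R y)"
  have R: "?R \<in> measurable (\<mu> \<Otimes>\<^sub>M \<mu>) borel"
    unfolding case_prod_unfold by (intro borel_measurable_Pair) simp_all
  have fst: "fst \<in> measurable borel (borel :: 'v measure)"
    by (intro borel_measurable_continuous_onI continuous_intros)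
  have "distr (\<mu> \<Otimes>\<^sub>M \<mu>) borel (\<lambda>(x, y). a *\<^sub>R x + b *\<^sub>R y) = distr (distr (\<mu> \<Otimes>\<^sub>M \<mu>) borel ?R) borel fst"
    unfolding distr_distr[OF fst R] by (simp add: comp_def case_prod_unfold)
  also have "\<dots> = distr (\<mu> \<Otimes>\<^sub>M \<mu>) borel fst"
    unfolding rotation_invariant[OF assms] ..
  also have "\<dots> = distr (\<mu> \<Otimes>\<^sub>M \<mu>) \<mu> fst"
    by (rule distr_cong) simp_all
  also have "\<dots> = \<mu>"
    by (rule distr_pair_fst)
  finally show ?thesis .
qed

text \<open>Stability with weights sqrt s / sqrt (s + h) and sqrt h / sqrt (s + h), whose squares
  add up to 1. The normalization explains the condition s + h > 0.\<close>

lemma integral_sqrt_add: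
  fixes F :: "'v \<Rightarrow> 'b::{banach, second_countable_topology}"
  assumes F: "F \<in> borel_measurable borel" and sh: "s \<ge> 0" "h \<ge> 0" "s + h > 0"
  shows "(\<integral>x. F (sqrt (s + h) *\<^sub>R x) \<partial>\<mu>) =
    (\<integral>p. F (sqrt s *\<^sub>R fst p + sqrt h *\<^sub>R snd p) \<partial>(\<mu> \<Otimes>\<^sub>M \<mu>))"
proof -
  define a b where "a = sqrt s / sqrt (s + h)" and "b = sqrt h / sqrt (s + h)"
  have ab: "a\<^sup>2 + b\<^sup>2 = 1"
    using sh by (simp add: a_def b_def power_divide add_divide_distrib[symmetric])
  have eqs: "sqrt (s + h) * a = sqrt s" "sqrt (s + h) * b = sqrt h"
    using sh by (simp_all add: a_def b_def)
  have [measurable]: "(\<lambda>x. F (sqrt (s + h) *\<^sub>R x)) \<in> borel_measurable borel"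
    using F by measurable
  have "(\<integral>x. F (sqrt (s + h) *\<^sub>R x) \<partial>\<mu>) =
      (\<integral>x. F (sqrt (s + h) *\<^sub>R x) \<partial>(distr (\<mu> \<Otimes>\<^sub>M \<mu>) borel (\<lambda>(x, y). a *\<^sub>R x + b *\<^sub>R y)))"
    unfolding distr_linear_combination[OF ab] ..
  also have "\<dots> = (\<integral>p. F (sqrt (s + h) *\<^sub>R (a *\<^sub>R fst p + b *\<^sub>R snd p)) \<partial>(\<mu> \<Otimes>\<^sub>M \<mu>))"
    by (subst integral_distr) (simp_all add: case_prod_unfold)
  finally show ?thesis
    by (simp add: scaleR_add_right eqs)
qed

definition tail :: "real \<Rightarrow> real" where
  "tail t = measure \<mu> {x. norm x > t}"

lemma tail_sets [measurable]: "{x. norm x > t} \<in> sets borel" "{x. norm x \<le> t} \<in> sets borel"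
  for t :: real
  by measurable

lemma tail_nonneg: "0 \<le> tail t"
  by (simp add: tail_def)

lemma tail_antimono: "s \<le> t \<Longrightarrow> tail t \<le> tail s"
  unfolding tail_def by (intro finite_measure_mono) auto

lemma tail_small:
  assumes "e > 0"
  obtains s where "s > 0" "tail s < e"
proof -
  obtain K where K: "compact K" "measure \<mu> (- K) < e"
    using borel_prob_space_tight[OF borel_prob_space_axioms assms] .
  then obtain s where s: "s > 0" "\<And>x. x \<in> K \<Longrightarrow> norm x \<le> s"
    using compact_imp_bounded[OF K(1)] by (auto simp: bounded_pos)
  have "tail s \<le> measure \<mu> (- K)"
    unfolding tail_def using s K(1)
    by (intro finite_measure_mono) (auto simp: borel_comp borel_compact dest: leD)
  then show ?thesis using that s K by force
qed

text \<open>
  Fernique's inequality: the rotated pair \<open>((x + y) / \<surd>2, (x - y) / \<surd>2)\<close> has the law of \<open>(x, y)\<close>, and a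
  large sum with a small difference forces both \<open>x\<close> and \<open>y\<close> to be large.
\<close>
lemma tail_square:
  "tail t * (1 - tail s) \<le> (tail ((t - s) / sqrt 2))\<^sup>2"
proof -
  define a :: real where "a = 1 / sqrt 2"
  have a: "a > 0" "a\<^sup>2 + a\<^sup>2 = 1" "2 * a = sqrt 2" "(t - s) / sqrt 2 = a * (t - s)"
    by (simp_all add: a_def power_divide real_div_sqrt)
  let ?R = "\<lambda>(x :: 'v, y). (a *\<^sub>R x + a *\<^sub>R y, a *\<^sub>R x - a *\<^sub>R y)"
  have R: "?R \<in> measurable (\<mu> \<Otimes>\<^sub>M \<mu>) borel"
    unfolding case_prod_unfold by (intro borel_measurable_Pair) simp_all
  let ?A = "{x :: 'v. norm x > t} \<times> {x. norm x \<le> s}"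
  let ?L = "{x :: 'v. norm x > (t - s) / sqrt 2}"
  have A: "?A \<in> sets (borel :: ('v \<times> 'v) measure)"
    unfolding borel_prod[symmetric] by (intro pair_measureI tail_sets)
  have times: "measure (\<mu> \<Otimes>\<^sub>M \<mu>) (B \<times> C) = measure \<mu> B * measure \<mu> C"
    if "B \<in> sets borel" "C \<in> sets borel" for B C
    using that by (simp add: measure_def emeasure_pair_measure_Times enn2real_mult)
  have "1 - tail s = measure \<mu> {x. norm x \<le> s}"
    using prob_compl[of "{x. norm x > s}"] by (simp add: tail_def not_less Compl_eq_Diff_UNIV[symmetric] Collect_neg_eq[symmetric])
  then have "tail t * (1 - tail s) = measure (\<mu> \<Otimes>\<^sub>M \<mu>) ?A"
    by (simp add: times tail_def)
  also have "\<dots> = measure (distr (\<mu> \<Otimes>\<^sub>M \<mu>) borel ?R) ?A"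
    unfolding rotation_invariant[OF a(2)] ..
  also have "\<dots> = measure (\<mu> \<Otimes>\<^sub>M \<mu>) (?R -` ?A)"
    by (subst measure_distr[OF R A]) (simp add: space_pair_measure)
  also have "\<dots> \<le> measure (\<mu> \<Otimes>\<^sub>M \<mu>) (?L \<times> ?L)"
  proof (rule pair.finite_measure_mono)
    show "?R -` ?A \<subseteq> ?L \<times> ?L"
    proof (rule subsetI)
      fix p assume p: "p \<in> ?R -` ?A"
      obtain x y where xy: "p = (x, y)" by (cases p)
      from p have *: "t < norm (a *\<^sub>R x + a *\<^sub>R y)" "norm (a *\<^sub>R x - a *\<^sub>R y) \<le> s"
        by (simp_all add: xy)
      have "(a *\<^sub>R x + a *\<^sub>R y) + (a *\<^sub>R x - a *\<^sub>R y) = sqrt 2 *\<^sub>R x"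
        "(a *\<^sub>R x + a *\<^sub>R y) - (a *\<^sub>R x - a *\<^sub>R y) = sqrt 2 *\<^sub>R y"
        unfolding a(3)[symmetric] by (simp_all add: scaleR_2 flip: scaleR_scaleR)
      then have "t - s < norm (sqrt 2 *\<^sub>R x)" "t - s < norm (sqrt 2 *\<^sub>R y)"
        using * norm_diff_ineq[of "a *\<^sub>R x + a *\<^sub>R y" "a *\<^sub>R x - a *\<^sub>R y"]
          norm_triangle_ineq2[of "a *\<^sub>R x + a *\<^sub>R y" "a *\<^sub>R x - a *\<^sub>R y"] by auto
      then show "p \<in> ?L \<times> ?L"
        by (simp add: xy field_simps)
    qed
  qed measurable
  also have "\<dots> = (tail ((t - s) / sqrt 2))\<^sup>2"
    by (simp add: times tail_def power2_eq_square)
  finally show ?thesis .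
qed

text \<open>Fix s with \<open>tail s < 1 / 2\<close>, so that \<open>tail_square\<close> gives tail
  t <= 2 (tail ((t - s) / sqrt 2))^2. For t >= 4 s the argument on the right is at least t / 2,
  because sqrt 2 <= 3 / 2. For t >= 2 S one of the two factors is at most 1 / 16. Doubling the
  radius thus divides the tail by 8, which beats the factor 4 gained by the squared radius.\<close>

lemma tail_geometric:
  obtains T where "T > 0" "\<And>n. tail (2 ^ n * T) \<le> (1 / 8) ^ n"
proof -
  obtain s where s: "s > 0" "tail s < 1 / 2"
    using tail_small[of "1 / 2"] by auto
  obtain S where S: "S > 0" "tail S < 1 / 16"
    using tail_small[of "1 / 16"] by auto
  define T where "T = max (4 * s) (2 * S)"
  have T: "T > 0" "4 * s \<le> T" "2 * S \<le> T" using s by (auto simp: T_def)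
  have step: "tail t \<le> tail (t / 2) / 8" if "t \<ge> T" for t
  proof -
    have "sqrt 2 \<le> 3 / 2"
      by (rule real_le_lsqrt) (simp_all add: power2_eq_square)
    then have "t / 2 * sqrt 2 \<le> t / 2 * (3 / 2)"
      using that T by (intro mult_left_mono) auto
    also have "\<dots> \<le> t - s" using that T by simp
    finally have "t / 2 \<le> (t - s) / sqrt 2" by (simp add: field_simps)
    then have half: "tail ((t - s) / sqrt 2) \<le> tail (t / 2)" by (rule tail_antimono)
    have "tail (t / 2) \<le> tail S" using that T by (intro tail_antimono) simp
    then have small: "tail (t / 2) \<le> 1 / 16" using S by simp
    have "tail t * (1 / 2) \<le> tail t * (1 - tail s)"
      using s tail_nonneg by (intro mult_left_mono) auto
    also have "\<dots> \<le> (tail ((t - s) / sqrt 2))\<^sup>2" by (rule tail_square)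
    also have "\<dots> \<le> (tail (t / 2))\<^sup>2" using half tail_nonneg by (intro power_mono)
    also have "\<dots> \<le> 1 / 16 * tail (t / 2)"
      unfolding power2_eq_square using small tail_nonneg by (intro mult_right_mono)
    finally show ?thesis by simp
  qed
  have "tail (2 ^ n * T) \<le> (1 / 8) ^ n" for n
  proof (induction n)
    case 0
    then show ?case by (simp add: tail_def)
  next
    case (Suc n)
    have "1 * T \<le> 2 ^ Suc n * T" using T by (intro mult_right_mono one_le_power) simp_all
    then have "tail (2 ^ Suc n * T) \<le> tail (2 ^ Suc n * T / 2) / 8" by (intro step) simp
    then show ?case using Suc by simp
  qed
  then show ?thesis using that T by blast
qed

text \<open>Dyadic decomposition: outside the ball of radius T the squared norm is dominated by the
  squared outer radius of the shell containing x. The resulting series is bounded by one with terms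
  4 T^2 (4 / 8)^n.\<close>

theorem integrable_norm_square: "integrable \<mu> (\<lambda>x. (norm x)\<^sup>2)"
proof -
  obtain T where T: "T > 0" "\<And>n. tail (2 ^ n * T) \<le> (1 / 8) ^ n"
    by (rule tail_geometric) (rule that)
  let ?c = "\<lambda>n. (2 ^ Suc n * T)\<^sup>2"
  let ?E = "\<lambda>n. {x :: 'v. norm x > 2 ^ n * T}"
  have pointwise: "ennreal ((norm x)\<^sup>2) \<le> ennreal (T\<^sup>2) + (\<Sum>n. ennreal (?c n) * indicator (?E n) x)"
    for x :: 'v
  proof (cases "norm x \<le> T")
    case True
    then have "(norm x)\<^sup>2 \<le> T\<^sup>2" by (intro power_mono) auto
    then show ?thesis by (intro add_increasing2) (auto intro: ennreal_leI)
  next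
    case False
    \<comment> \<open>The least m with x in the ball of radius 2^m T locates the shell. Since x lies
      outside the ball of radius T, m is a successor \<open>Suc n\<close>, and the single term with
      index n of the series already dominates.\<close>
    define m where "m = (LEAST m. norm x \<le> 2 ^ m * T)"
    obtain k where "norm x / T < 2 ^ k"
      using real_arch_pow[of 2 "norm x / T"] by auto
    then have "norm x \<le> 2 ^ k * T" using T by (simp add: field_simps)
    then have m: "norm x \<le> 2 ^ m * T"
      unfolding m_def by (rule LeastI)
    then obtain n where n: "m = Suc n" using False by (cases m) auto
    have "\<not> norm x \<le> 2 ^ n * T"
      using not_less_Least[of n "\<lambda>m. norm x \<le> 2 ^ m * T"] n by (simp add: m_def[symmetric])
    then have "ennreal (?c n) = (\<Sum>i\<in>{n}. ennreal (?c i) * indicator (?E i) x)" by simp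
    also have "\<dots> \<le> (\<Sum>n. ennreal (?c n) * indicator (?E n) x)"
      by (rule sum_le_suminf) auto
    finally have "ennreal (?c n) \<le> (\<Sum>n. ennreal (?c n) * indicator (?E n) x)" .
    moreover have "(norm x)\<^sup>2 \<le> ?c n"
      using m n by (intro power_mono) auto
    then have "ennreal ((norm x)\<^sup>2) \<le> ennreal (?c n)" by (rule ennreal_leI)
    ultimately have "ennreal ((norm x)\<^sup>2) \<le> (\<Sum>n. ennreal (?c n) * indicator (?E n) x)"
      by (rule order_trans[rotated])
    then show ?thesis by (rule add_increasing[rotated]) simp
  qed
  have "(\<integral>\<^sup>+x. ennreal ((norm x)\<^sup>2) \<partial>\<mu>) \<le>
      (\<integral>\<^sup>+x. ennreal (T\<^sup>2) + (\<Sum>n. ennreal (?c n) * indicator (?E n) x) \<partial>\<mu>)"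
    by (intro nn_integral_mono pointwise)
  also have "\<dots> = ennreal (T\<^sup>2) + (\<integral>\<^sup>+x. (\<Sum>n. ennreal (?c n) * indicator (?E n) x) \<partial>\<mu>)"
    using emeasure_space_1 by (subst nn_integral_add) simp_all
  also have "\<dots> = ennreal (T\<^sup>2) + (\<Sum>n. ennreal (?c n) * emeasure \<mu> (?E n))"
    by (subst nn_integral_suminf) (simp_all add: nn_integral_cmult)
  also have "\<dots> \<le> ennreal (T\<^sup>2) + (\<Sum>n. ennreal (4 * T\<^sup>2 * (1 / 2) ^ n))"
  proof (intro add_left_mono suminf_le)
    fix n
    have pow4: "((2 :: real) ^ n)\<^sup>2 = 4 ^ n"
      by (induction n) (simp_all add: power_mult_distrib)
    have "?c n * tail (2 ^ n * T) \<le> ?c n * (1 / 8) ^ n"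
      by (intro mult_left_mono T) simp
    also have "\<dots> = 4 * T\<^sup>2 * (4 ^ n * (1 / 8) ^ n)"
      by (simp add: power_mult_distrib pow4)
    also have "4 ^ n * (1 / 8) ^ n = (1 / 2 :: real) ^ n"
      by (simp flip: power_mult_distrib)
    finally have "ennreal (?c n * tail (2 ^ n * T)) \<le> ennreal (4 * T\<^sup>2 * (1 / 2) ^ n)"
      by (rule ennreal_leI)
    then show "ennreal (?c n) * emeasure \<mu> (?E n) \<le> ennreal (4 * T\<^sup>2 * (1 / 2) ^ n)"
      by (simp add: tail_def emeasure_eq_measure ennreal_mult')
  qed simp_all
  also have "\<dots> < \<infinity>"
  proof -
    have "summable (\<lambda>n. 4 * T\<^sup>2 * (1 / 2) ^ n)"
      by (intro summable_mult summable_geometric) simp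
    then have "(\<Sum>n. ennreal (4 * T\<^sup>2 * (1 / 2) ^ n)) \<noteq> top"
      by (subst suminf_ennreal2) simp_all
    then show ?thesis by (simp add: less_top)
  qed
  finally show ?thesis
    by (intro integrableI_bounded) simp_all
qed

lemma integrable_norm: "integrable \<mu> norm"
proof (rule Bochner_Integration.integrable_bound)
  show "integrable \<mu> (\<lambda>x. 1 + (norm x)\<^sup>2)"
    by (intro Bochner_Integration.integrable_add integrable_norm_square) simp
  have "y \<le> 1 + y\<^sup>2" for y :: real
    using sum_power2_ge_zero[of "y - 1 / 2" 0] by (simp add: power2_eq_square algebra_simps)
  then show "AE x in \<mu>. norm (norm x) \<le> norm (1 + (norm x)\<^sup>2)"
    by (intro AE_I2) simp
qed simp

end

section \<open>Taylor expansion\<close>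

text \<open>Mean value inequality for an upper right Dini derivative. The set where g t - K t does
  not exceed its value at 0 is compact, so it has a last point; if that point were below 1, the
  local hypothesis would push it further right.\<close>

lemma right_increments_le_imp_le:
  fixes g :: "real \<Rightarrow> real"
  assumes g: "continuous_on {0..1} g"
    and step: "\<And>s. 0 \<le> s \<Longrightarrow> s < 1 \<Longrightarrow> \<exists>\<delta>>0. \<forall>h. 0 < h \<and> h < \<delta> \<longrightarrow> g (s + h) \<le> g s + K * h"
  shows "g 1 \<le> g 0 + K"
proof -
  define k where "k t = g t - K * t" for t
  have k: "continuous_on {0..1} k"
    unfolding k_def by (intro continuous_intros g)
  define A where "A = {t \<in> {0..1}. k t \<le> k 0}"
  have "closed A"
    unfolding A_def using k by (intro continuous_on_closed_Collect_le continuous_on_const) simp_all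
  moreover have "A = A \<inter> {0..1}" by (auto simp: A_def)
  ultimately have "compact A"
    by (metis closed_Int_compact compact_Icc)
  moreover have "0 \<in> A" by (simp add: A_def)
  ultimately obtain s where s: "s \<in> A" "\<And>t. t \<in> A \<Longrightarrow> t \<le> s"
    using compact_attains_sup[of A] by blast
  have "s = 1"
  proof (rule ccontr)
    assume "s \<noteq> 1"
    then have s01: "0 \<le> s" "s < 1" using s(1) by (auto simp: A_def)
    then obtain \<delta> where \<delta>: "\<delta> > 0" "\<And>h. 0 < h \<Longrightarrow> h < \<delta> \<Longrightarrow> g (s + h) \<le> g s + K * h"
      using step by blast
    define h where "h = min (\<delta> / 2) (1 - s)"
    have h: "0 < h" "h < \<delta>" "s + h \<le> 1" using \<delta>(1) s01 by (auto simp: h_def)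
    have "k (s + h) \<le> k s"
      using \<delta>(2)[OF h(1,2)] by (simp add: k_def algebra_simps)
    then have "s + h \<in> A" using s(1) h s01 by (auto simp: A_def)
    then show False using s(2)[of "s + h"] h by simp
  qed
  then show ?thesis using s(1) by (simp add: A_def k_def)
qed

section \<open>Second-order Taylor remainder of a function with bounded derivatives\<close>

locale bounded_C2 =
  fixes f :: "'v::{banach, second_countable_topology} \<Rightarrow> real"
    and Df :: "'v \<Rightarrow> ('v \<Rightarrow>\<^sub>L real)"
    and D2f :: "'v \<Rightarrow> 'v bilinear_form"
    and C B :: real
  assumes Df: "(f has_derivative blinfun_apply (Df x)) (at x)"
    and D2f: "(Df has_derivative blinfun_apply (D2f x)) (at x)"
    and cont_D2f: "continuous_on UNIV D2f"
    and Df_le: "norm (Df x) \<le> C"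
    and D2f_le: "norm (D2f x) \<le> B"
begin

lemma cont_f: "continuous_on UNIV f"
  using Df by (intro continuous_at_imp_continuous_on ballI) (rule has_derivative_continuous)

lemma cont_Df: "continuous_on UNIV Df"
  using D2f by (intro continuous_at_imp_continuous_on ballI) (rule has_derivative_continuous)

lemma f_lipschitz: "\<bar>f x - f y\<bar> \<le> C * norm (x - y)"
  using differentiable_bound[of UNIV f "\<lambda>x. blinfun_apply (Df x)" C x y] Df Df_le
  by (simp add: norm_blinfun.rep_eq[symmetric])

lemma f_growth: "\<bar>f x\<bar> \<le> \<bar>f 0\<bar> + C * norm x"
  using f_lipschitz[of x 0] by simp

lemma C_nonneg: "0 \<le> C" and B_nonneg: "0 \<le> B"
  using Df_le[of 0] D2f_le[of 0] norm_ge_zero order_trans by metis+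

definition taylor_rem :: "'v \<Rightarrow> 'v \<Rightarrow> real" where
  "taylor_rem z w = f (z + w) - f z - Df z w - form_apply (D2f z) w w / 2"

lemma taylor_rem_le:
  assumes \<eta>: "\<And>x. x \<in> closed_segment z (z + w) \<Longrightarrow> norm (D2f x - D2f z) \<le> \<eta>"
  shows "\<bar>taylor_rem z w\<bar> \<le> \<eta> * (norm w)\<^sup>2"
proof -
  have seg: "z + u *\<^sub>R w \<in> closed_segment z (z + w)" if "u \<in> {0..1}" for u
    using that by (auto simp: closed_segment_def algebra_simps intro!: exI[of _ u])
  have Df_close: "norm (Df (z + u *\<^sub>R w) - Df z - D2f z (u *\<^sub>R w)) \<le> \<eta> * norm w" if u: "u \<in> {0..1}" for u
  proof -
    \<comment> \<open>The map x to Df x - D2f z x has derivative \<open>D2f x - D2f z\<close>, whose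
      norm is at most \<eta> on the segment.\<close>
    have "norm ((Df (z + u *\<^sub>R w) - D2f z (z + u *\<^sub>R w)) - (Df z - D2f z z)) \<le> \<eta> * norm ((z + u *\<^sub>R w) - z)"
    proof (rule differentiable_bound[where S = "closed_segment z (z + w)"
          and f' = "\<lambda>x. blinfun_apply (D2f x - D2f z)"])
      fix x assume x: "x \<in> closed_segment z (z + w)"
      have "((\<lambda>x. Df x - D2f z x) has_derivative (\<lambda>h. D2f x h - D2f z h)) (at x within closed_segment z (z + w))"
        by (intro has_derivative_diff has_derivative_at_withinI[OF D2f] bounded_linear_imp_has_derivative
            blinfun.bounded_linear_right)
      then show "((\<lambda>x. Df x - D2f z x) has_derivative blinfun_apply (D2f x - D2f z))
          (at x within closed_segment z (z + w))"
        by (simp add: blinfun.diff_left[abs_def])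
      show "onorm (blinfun_apply (D2f x - D2f z)) \<le> \<eta>"
        using \<eta>[OF x] by (simp add: norm_blinfun.rep_eq)
    qed (use seg[OF u] in auto)
    also have "\<dots> \<le> \<eta> * norm w"
      using u \<eta>[of z] by (auto intro!: mult_left_mono mult_left_le_one_le simp: order_trans[OF norm_ge_zero])
    finally show ?thesis
      by (simp add: blinfun.add_right algebra_simps)
  qed
  let ?\<phi> = "\<lambda>u. f (z + u *\<^sub>R w) - u * Df z w - u\<^sup>2 / 2 * form_apply (D2f z) w w"
  let ?\<phi>' = "\<lambda>u. Df (z + u *\<^sub>R w) w - Df z w - u * form_apply (D2f z) w w"
  have "norm (?\<phi> 1 - ?\<phi> 0) \<le> \<eta> * (norm w)\<^sup>2 * norm (1 - 0 :: real)"
  proof (rule differentiable_bound[where S = "{0..1}" and f' = "\<lambda>u t. t * ?\<phi>' u"])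
    fix u :: real assume u: "u \<in> {0..1}"
    have "((\<lambda>u. f (z + u *\<^sub>R w)) has_derivative (\<lambda>t. Df (z + u *\<^sub>R w) (t *\<^sub>R w))) (at u within {0..1})"
      by (rule has_derivative_compose[OF _ Df]) (auto intro!: derivative_eq_intros)
    moreover have "((\<lambda>u. u * Df z w + u\<^sup>2 / 2 * form_apply (D2f z) w w) has_derivative
        (\<lambda>t. t * Df z w + t * u * form_apply (D2f z) w w)) (at u within {0..1})"
      by (auto intro!: derivative_eq_intros simp: algebra_simps)
    ultimately have "((\<lambda>u. f (z + u *\<^sub>R w) - (u * Df z w + u\<^sup>2 / 2 * form_apply (D2f z) w w)) has_derivative
        (\<lambda>t. Df (z + u *\<^sub>R w) (t *\<^sub>R w) - (t * Df z w + t * u * form_apply (D2f z) w w))) (at u within {0..1})"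
      by (rule has_derivative_diff)
    then show "(?\<phi> has_derivative (\<lambda>t. t * ?\<phi>' u)) (at u within {0..1})"
      by (simp add: blinfun.scaleR_right algebra_simps)
    have "?\<phi>' u = (Df (z + u *\<^sub>R w) - Df z - D2f z (u *\<^sub>R w)) w"
      by (simp add: blinfun.diff_left blinfun.scaleR_right blinfun.scaleR_left)
    also have "\<bar>\<dots>\<bar> \<le> norm (Df (z + u *\<^sub>R w) - Df z - D2f z (u *\<^sub>R w)) * norm w"
      using norm_blinfun[of "Df (z + u *\<^sub>R w) - Df z - D2f z (u *\<^sub>R w)" w] by simp
    also have "\<dots> \<le> \<eta> * norm w * norm w"
      using Df_close[OF u] by (rule mult_right_mono) simp
    finally have le: "\<bar>?\<phi>' u\<bar> \<le> \<eta> * (norm w)\<^sup>2"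
      by (simp add: power2_eq_square mult.assoc)
    show "onorm (\<lambda>t. t * ?\<phi>' u) \<le> \<eta> * (norm w)\<^sup>2"
    proof (rule onorm_le)
      fix t :: real
      show "norm (t * ?\<phi>' u) \<le> \<eta> * (norm w)\<^sup>2 * norm t"
        using mult_right_mono[OF le, of "\<bar>t\<bar>"] by (simp add: abs_mult mult.commute)
    qed
  qed simp_all
  then show ?thesis by (simp add: taylor_rem_def algebra_simps)
qed

text \<open>This bound is uniform in the base point. With increment sqrt h x it is proportional to
  h, so after division by h it dominates the remainder.\<close>

lemma taylor_rem_le_bound: "\<bar>taylor_rem z w\<bar> \<le> 2 * B * (norm w)\<^sup>2"
proof (rule taylor_rem_le)
  fix x
  show "norm (D2f x - D2f z) \<le> 2 * B"
    using norm_triangle_ineq4[of "D2f x" "D2f z"] D2f_le[of x] D2f_le[of z] by linarith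
qed

text \<open>\<open>D2f\<close> is only assumed continuous, and the base point moves. Since z n tends
  to z0, the whole segment eventually lies in a small ball around z0, where \<open>D2f\<close>
  varies little. The squared increment contributes exactly the factor \<open>h n\<close>.\<close>

lemma taylor_rem_little_o:
  assumes z: "z \<longlonglongrightarrow> z0" and h: "h \<longlonglongrightarrow> 0" "\<And>n. h n > 0"
  shows "(\<lambda>n. taylor_rem (z n) (sqrt (h n) *\<^sub>R x) / h n) \<longlonglongrightarrow> 0"
proof (rule LIMSEQ_I)
  fix e :: real assume "e > 0"
  \<comment> \<open>The added 1 in the denominator gives a strict bound by e and covers x =
    0.\<close>
  define \<eta> where "\<eta> = e / (1 + (norm x)\<^sup>2)"
  have "1 + (norm x)\<^sup>2 > 0" by (simp add: add_pos_nonneg)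
  then have \<eta>: "\<eta> > 0" "\<eta> * (norm x)\<^sup>2 < e"
    using \<open>e > 0\<close> by (simp_all add: \<eta>_def field_simps)
  have "isCont D2f z0"
    using cont_D2f continuous_on_eq_continuous_at by blast
  then obtain d where d: "d > 0" "\<And>y. dist y z0 < d \<Longrightarrow> dist (D2f y) (D2f z0) < \<eta> / 2"
    using \<eta>(1) unfolding continuous_at_eps_delta by (metis half_gt_zero)
  have w: "(\<lambda>n. z n + sqrt (h n) *\<^sub>R x) \<longlonglongrightarrow> z0 + sqrt 0 *\<^sub>R x"
    by (intro tendsto_intros z h)
  have "\<forall>\<^sub>F n in sequentially. dist (z n) z0 < d"
    using z d(1) by (rule tendstoD)
  moreover have "\<forall>\<^sub>F n in sequentially. dist (z n + sqrt (h n) *\<^sub>R x) z0 < d"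
    using w d(1) by (auto dest: tendstoD)
  ultimately have "\<forall>\<^sub>F n in sequentially. norm (taylor_rem (z n) (sqrt (h n) *\<^sub>R x) / h n - 0) < e"
  proof eventually_elim
    case (elim n)
    have "\<bar>taylor_rem (z n) (sqrt (h n) *\<^sub>R x)\<bar> \<le> \<eta> * (norm (sqrt (h n) *\<^sub>R x))\<^sup>2"
    proof (rule taylor_rem_le)
      fix y assume y: "y \<in> closed_segment (z n) (z n + sqrt (h n) *\<^sub>R x)"
      have "closed_segment (z n) (z n + sqrt (h n) *\<^sub>R x) \<subseteq> ball z0 d"
        using elim by (intro closed_segment_subset) (auto simp: dist_commute)
      then have "dist (D2f y) (D2f z0) < \<eta> / 2"
        using y by (intro d) (auto simp: dist_commute)
      moreover have "dist (D2f (z n)) (D2f z0) < \<eta> / 2"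
        using elim by (intro d)
      ultimately show "norm (D2f y - D2f (z n)) \<le> \<eta>"
        using dist_triangle2[of "D2f y" "D2f (z n)" "D2f z0"] by (simp add: dist_norm)
    qed
    also have "\<dots> = \<eta> * (norm x)\<^sup>2 * h n"
      using h(2)[of n] by (simp add: power_mult_distrib)
    also have "\<dots> < e * h n"
      using \<eta>(2) h(2) by (rule mult_strict_right_mono)
    finally show ?case
      using h(2)[of n] by (simp add: field_simps)
  qed
  then show "\<exists>N. \<forall>n\<ge>N. norm (taylor_rem (z n) (sqrt (h n) *\<^sub>R x) / h n - 0) < e"
    by (simp add: eventually_sequentially)
qed

lemma continuous_taylor_rem: "continuous_on UNIV (\<lambda>p. taylor_rem (fst p) (snd p))"
proof -
  have Df': "continuous_on UNIV (\<lambda>p :: 'v \<times> 'v. Df (fst p) (snd p))"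
    by (intro bounded_bilinear.continuous_on[OF bounded_bilinear_blinfun_apply]
        continuous_on_compose2[OF cont_Df] continuous_intros) auto
  have D2f': "continuous_on UNIV (\<lambda>p :: 'v \<times> 'v. form_apply (D2f (fst p)) (snd p) (snd p))"
    by (intro bounded_bilinear.continuous_on[OF bounded_bilinear_blinfun_apply]
        continuous_on_compose2[OF cont_D2f] continuous_intros) auto
  show ?thesis
    unfolding taylor_rem_def
    by (intro continuous_intros Df' D2f' continuous_on_compose2[OF cont_f]) auto
qed

end

section \<open>Gaussian interpolation\<close>

lemma integrable_comp_fst:
  fixes F :: "'a \<Rightarrow> 'b::{banach, second_countable_topology}"
  assumes "prob_space N" "integrable M F"
  shows "integrable (M \<Otimes>\<^sub>M N) (\<lambda>p. F (fst p))"
  using integrable_distr[of fst "M \<Otimes>\<^sub>M N" M F] assms by (simp add: prob_space.distr_pair_fst)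

lemma integrable_comp_snd:
  fixes F :: "'a \<Rightarrow> 'b::{banach, second_countable_topology}"
  assumes "prob_space M" "prob_space N" "integrable N F"
  shows "integrable (M \<Otimes>\<^sub>M N) (\<lambda>p. F (snd p))"
proof -
  interpret pair_prob_space N M using assms by (simp add: pair_prob_space_def pair_sigma_finite_def prob_space_imp_sigma_finite)
  show ?thesis
    using integrable_product_swap[OF integrable_comp_fst[OF assms(1,3)]] by (simp add: case_prod_unfold)
qed

context gaussian_measure
begin

lemma integrable_id: "integrable \<mu> (\<lambda>x. x)"
  using integrable_norm by (subst integrable_norm_iff[symmetric]) simp_all

lemma integrable_form: "integrable \<mu> (\<lambda>x. form_apply H x x)"
proof (rule Bochner_Integration.integrable_bound)
  show "integrable \<mu> (\<lambda>x. norm H * (norm x)\<^sup>2)"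
    by (intro integrable_mult_right integrable_norm_square)
  have "continuous_on UNIV (\<lambda>x. form_apply H x x)"
    by (intro bounded_bilinear.continuous_on[OF bounded_bilinear_blinfun_apply] continuous_intros)
  then have "(\<lambda>x. form_apply H x x) \<in> borel_measurable borel"
    by (rule borel_measurable_continuous_onI)
  then show "(\<lambda>x. form_apply H x x) \<in> borel_measurable \<mu>"
    by simp
  have "\<bar>form_apply H x x\<bar> \<le> norm H * (norm x)\<^sup>2" for x
  proof -
    have "\<bar>form_apply H x x\<bar> \<le> norm (H x) * norm x"
      using norm_blinfun[of "H x" x] by simp
    also have "\<dots> \<le> norm H * norm x * norm x"
      by (intro mult_right_mono norm_blinfun) simp
    finally show ?thesis by (simp add: power2_eq_square mult.assoc)
  qed
  then show "AE x in \<mu>. norm (form_apply H x x) \<le> norm (norm H * (norm x)\<^sup>2)"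
    by (intro AE_I2) simp
qed

end

context bounded_C2
begin

lemma f_measurable [measurable]: "f \<in> borel_measurable borel"
  by (rule borel_measurable_continuous_onI[OF cont_f])

lemma taylor_rem_measurable [measurable (raw)]:
  assumes [measurable]: "Z \<in> borel_measurable N" "W \<in> borel_measurable N"
  shows "(\<lambda>q. taylor_rem (Z q) (W q)) \<in> borel_measurable N"
proof -
  have "(\<lambda>q. (Z q, W q)) \<in> borel_measurable N" by (intro borel_measurable_Pair) measurable
  from measurable_compose[OF this borel_measurable_continuous_onI[OF continuous_taylor_rem]]
  show ?thesis by simp
qed

lemma integrable_f:
  assumes "prob_space N" and Z: "integrable N Z"
  shows "integrable N (\<lambda>q. f (Z q))"
proof (rule Bochner_Integration.integrable_bound)
  interpret prob_space N by fact
  show "integrable N (\<lambda>q. \<bar>f 0\<bar> + C * norm (Z q))"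
    by (intro Bochner_Integration.integrable_add integrable_mult_right integrable_norm Z) simp
  show "(\<lambda>q. f (Z q)) \<in> borel_measurable N"
    using Z by measurable
  show "AE q in N. norm (f (Z q)) \<le> norm (\<bar>f 0\<bar> + C * norm (Z q))"
    using f_growth by (intro AE_I2) (simp add: order_trans[OF _ abs_ge_self])
qed

lemma integrable_taylor_rem:
  assumes Z: "Z \<in> borel_measurable N" and W: "W \<in> borel_measurable N" "integrable N (\<lambda>q. (norm (W q))\<^sup>2)"
  shows "integrable N (\<lambda>q. taylor_rem (Z q) (a *\<^sub>R W q))"
proof (rule Bochner_Integration.integrable_bound)
  show "integrable N (\<lambda>q. 2 * B * a\<^sup>2 * (norm (W q))\<^sup>2)"
    by (intro integrable_mult_right W)
  show "(\<lambda>q. taylor_rem (Z q) (a *\<^sub>R W q)) \<in> borel_measurable N"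
    using Z W by measurable
  show "AE q in N. norm (taylor_rem (Z q) (a *\<^sub>R W q)) \<le> norm (2 * B * a\<^sup>2 * (norm (W q))\<^sup>2)"
  proof (rule AE_I2)
    fix q
    show "norm (taylor_rem (Z q) (a *\<^sub>R W q)) \<le> norm (2 * B * a\<^sup>2 * (norm (W q))\<^sup>2)"
      using taylor_rem_le_bound[of "Z q" "a *\<^sub>R W q"] B_nonneg
      by (simp add: power_mult_distrib abs_mult mult.assoc)
  qed
qed

text \<open>Dominated convergence with majorant 2 B times the squared norm of W, which is where the
  second moment enters. The one-sided limit is tested along sequences because dominated convergence
  is applied to sequences.\<close>

lemma integral_taylor_rem_little_o:
  assumes Z: "\<And>h. Z h \<in> borel_measurable N" "\<And>q. ((\<lambda>h. Z h q) \<longlongrightarrow> Z 0 q) (at_right 0)"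
    and W: "W \<in> borel_measurable N" "integrable N (\<lambda>q. (norm (W q))\<^sup>2)"
  shows "((\<lambda>h. (\<integral>q. taylor_rem (Z h q) (sqrt h *\<^sub>R W q) \<partial>N) / h) \<longlongrightarrow> 0) (at_right 0)"
  unfolding tendsto_at_iff_sequentially comp_def
proof (intro allI impI)
  fix h :: "nat \<Rightarrow> real" assume h: "\<forall>i. h i \<in> {0<..} - {0}" "h \<longlonglongrightarrow> 0"
  have pos: "h n > 0" for n using h(1) by simp
  have "(\<lambda>n. \<integral>q. taylor_rem (Z (h n) q) (sqrt (h n) *\<^sub>R W q) / h n \<partial>N) \<longlonglongrightarrow> (\<integral>q. 0 \<partial>N)"
  proof (rule integral_dominated_convergence[where w = "\<lambda>q. 2 * B * (norm (W q))\<^sup>2"])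
    show "integrable N (\<lambda>q. 2 * B * (norm (W q))\<^sup>2)"
      by (intro integrable_mult_right W)
    show "(\<lambda>q. taylor_rem (Z (h n) q) (sqrt (h n) *\<^sub>R W q) / h n) \<in> borel_measurable N" for n
      using Z(1)[of "h n"] W(1) by measurable
    show "AE q in N. (\<lambda>n. taylor_rem (Z (h n) q) (sqrt (h n) *\<^sub>R W q) / h n) \<longlonglongrightarrow> 0"
    proof (intro AE_I2 taylor_rem_little_o)
      fix q
      show "(\<lambda>n. Z (h n) q) \<longlonglongrightarrow> Z 0 q"
        using Z(2)[of q] h unfolding tendsto_at_iff_sequentially comp_def by blast
    qed (use h(2) pos in auto)
    show "AE q in N. norm (taylor_rem (Z (h n) q) (sqrt (h n) *\<^sub>R W q) / h n) \<le> 2 * B * (norm (W q))\<^sup>2" for n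
    proof (rule AE_I2)
      fix q
      show "norm (taylor_rem (Z (h n) q) (sqrt (h n) *\<^sub>R W q) / h n) \<le> 2 * B * (norm (W q))\<^sup>2"
        using taylor_rem_le_bound[of "Z (h n) q" "sqrt (h n) *\<^sub>R W q"] pos[of n]
        by (simp add: power_mult_distrib field_simps)
    qed
  qed simp
  then show "(\<lambda>n. (\<integral>q. taylor_rem (Z (h n) q) (sqrt (h n) *\<^sub>R W q) \<partial>N) / h n) \<longlonglongrightarrow> 0"
    by simp
qed

text \<open>The linear term integrates to zero because \<mu> is centered, and sqrt h squared turns
  the quadratic term into one of order h.\<close>

lemma gaussian_expansion:
  assumes "gaussian_measure \<mu>" "h \<ge> 0"
  shows "(\<integral>x. f (z + sqrt h *\<^sub>R x) \<partial>\<mu>) =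
    f z + h / 2 * (\<integral>x. form_apply (D2f z) x x \<partial>\<mu>) + (\<integral>x. taylor_rem z (sqrt h *\<^sub>R x) \<partial>\<mu>)"
proof -
  interpret gaussian_measure \<mu> by fact
  have rem: "integrable \<mu> (\<lambda>x. taylor_rem z (sqrt h *\<^sub>R x))"
    by (intro integrable_taylor_rem integrable_norm_square) simp_all
  have "f (z + sqrt h *\<^sub>R x) =
      f z + sqrt h * Df z x + h / 2 * form_apply (D2f z) x x + taylor_rem z (sqrt h *\<^sub>R x)" for x
    using \<open>h \<ge> 0\<close> by (simp add: taylor_rem_def blinfun.scaleR_right blinfun.scaleR_left field_simps
        flip: power2_eq_square)
  then have "(\<integral>x. f (z + sqrt h *\<^sub>R x) \<partial>\<mu>) =
      (\<integral>x. f z + sqrt h * Df z x + h / 2 * form_apply (D2f z) x x + taylor_rem z (sqrt h *\<^sub>R x) \<partial>\<mu>)"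
    by simp
  also have "\<dots> = (\<integral>x. f z + sqrt h * Df z x + h / 2 * form_apply (D2f z) x x \<partial>\<mu>)
      + (\<integral>x. taylor_rem z (sqrt h *\<^sub>R x) \<partial>\<mu>)"
    by (intro Bochner_Integration.integral_add Bochner_Integration.integrable_add integrable_mult_right
        integrable_functional integrable_form rem) simp
  also have "(\<integral>x. f z + sqrt h * Df z x + h / 2 * form_apply (D2f z) x x \<partial>\<mu>) =
      (\<integral>x. f z + sqrt h * Df z x \<partial>\<mu>) + (\<integral>x. h / 2 * form_apply (D2f z) x x \<partial>\<mu>)"
    by (intro Bochner_Integration.integral_add Bochner_Integration.integrable_add integrable_mult_right
        integrable_functional integrable_form) simp
  also have "(\<integral>x. f z + sqrt h * Df z x \<partial>\<mu>) = f z"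
    using integrable_functional[of "Df z"] integral_functional[of "Df z"] prob_space
    by (subst Bochner_Integration.integral_add) simp_all
  finally show ?thesis by simp
qed

text \<open>Fubini isolates the second variable, stability splits it into independent parts of
  scales sqrt s and sqrt h, and Fubini regroups the first part with the other variable. The
  increment of scale sqrt h stays in an inner integral, ready for the expansion.\<close>

lemma integral_split:
  assumes \<mu>: "gaussian_measure \<mu>" and \<nu>: "gaussian_measure \<nu>" and sh: "s \<ge> 0" "h \<ge> 0" "s + h > 0"
  shows "(\<integral>p. f (a *\<^sub>R fst p + sqrt (s + h) *\<^sub>R snd p) \<partial>(\<nu> \<Otimes>\<^sub>M \<mu>)) =
    (\<integral>p. (\<integral>x. f ((a *\<^sub>R fst p + sqrt s *\<^sub>R snd p) + sqrt h *\<^sub>R x) \<partial>\<mu>) \<partial>(\<nu> \<Otimes>\<^sub>M \<mu>))"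
proof -
  interpret \<mu>: gaussian_measure \<mu> by fact
  interpret \<nu>: gaussian_measure \<nu> by fact
  interpret \<nu>\<mu>: pair_prob_space \<nu> \<mu> ..
  interpret \<nu>\<mu>\<mu>: pair_prob_space "\<nu> \<Otimes>\<^sub>M \<mu>" \<mu> ..
  note prob = \<mu>.prob_space_axioms \<nu>.prob_space_axioms \<mu>.pair.P.prob_space_axioms \<nu>\<mu>.P.prob_space_axioms
    \<nu>\<mu>\<mu>.P.prob_space_axioms
  note int = Bochner_Integration.integrable_add integrable_scaleR_right
    integrable_comp_fst[where F = "\<lambda>x. x"] integrable_comp_snd[where F = "\<lambda>x. x"]
    \<mu>.integrable_id \<nu>.integrable_id prob
  have "(\<integral>p. f (a *\<^sub>R fst p + sqrt (s + h) *\<^sub>R snd p) \<partial>(\<nu> \<Otimes>\<^sub>M \<mu>)) =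
      (\<integral>y. (\<integral>x. f (a *\<^sub>R y + sqrt (s + h) *\<^sub>R x) \<partial>\<mu>) \<partial>\<nu>)"
    by (subst \<nu>\<mu>.integral_fst'[symmetric]) (auto intro!: integrable_f int)
  also have "\<dots> = (\<integral>y. (\<integral>q. f (a *\<^sub>R y + (sqrt s *\<^sub>R fst q + sqrt h *\<^sub>R snd q)) \<partial>(\<mu> \<Otimes>\<^sub>M \<mu>)) \<partial>\<nu>)"
    using sh by (subst \<mu>.integral_sqrt_add) simp_all
  also have "\<dots> = (\<integral>y. (\<integral>x. (\<integral>x'. f (a *\<^sub>R y + (sqrt s *\<^sub>R x + sqrt h *\<^sub>R x')) \<partial>\<mu>) \<partial>\<mu>) \<partial>\<nu>)"
    by (subst \<mu>.pair.integral_fst'[symmetric]) (auto intro!: integrable_f int)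
  also have "\<dots> = (\<integral>p. (\<integral>x. f ((a *\<^sub>R fst p + sqrt s *\<^sub>R snd p) + sqrt h *\<^sub>R x) \<partial>\<mu>) \<partial>(\<nu> \<Otimes>\<^sub>M \<mu>))"
  proof -
    have "integrable (\<nu> \<Otimes>\<^sub>M \<mu>) (\<lambda>p. (\<integral>x. f ((a *\<^sub>R fst p + sqrt s *\<^sub>R snd p) + sqrt h *\<^sub>R x) \<partial>\<mu>))"
    proof -
      have "integrable ((\<nu> \<Otimes>\<^sub>M \<mu>) \<Otimes>\<^sub>M \<mu>)
          (\<lambda>q. f ((a *\<^sub>R fst (fst q) + sqrt s *\<^sub>R snd (fst q)) + sqrt h *\<^sub>R snd q))"
        by (intro integrable_f int integrable_comp_fst[where F = fst] integrable_comp_fst[where F = snd])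
      from \<nu>\<mu>\<mu>.integrable_fst'[OF this] show ?thesis by simp
    qed
    from \<nu>\<mu>.integral_fst'[OF this] show ?thesis by (simp add: add.assoc)
  qed
  finally show ?thesis .
qed

end

theorem (in bounded_C2) gaussian_comparison:
  assumes \<mu>: "gaussian_measure \<mu>" and \<nu>: "gaussian_measure \<nu>"
    and comparison: "\<And>z. (\<integral>x. form_apply (D2f z) x x \<partial>\<mu>) \<le> (\<integral>x. form_apply (D2f z) x x \<partial>\<nu>) + c"
  shows "(\<integral>x. f x \<partial>\<mu>) \<le> (\<integral>x. f x \<partial>\<nu>) + c / 2"
proof -
  interpret \<mu>: gaussian_measure \<mu> by fact
  interpret \<nu>: gaussian_measure \<nu> by fact
  interpret \<nu>\<mu>: pair_prob_space \<nu> \<mu> ..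
  interpret \<mu>\<nu>: pair_prob_space \<mu> \<nu> ..
  interpret P\<mu>: pair_prob_space "\<nu> \<Otimes>\<^sub>M \<mu>" \<mu> ..
  interpret P\<nu>: pair_prob_space "\<nu> \<Otimes>\<^sub>M \<mu>" \<nu> ..
  note prob = \<mu>.prob_space_axioms \<nu>.prob_space_axioms \<nu>\<mu>.P.prob_space_axioms
    P\<mu>.P.prob_space_axioms P\<nu>.P.prob_space_axioms
  note int = Bochner_Integration.integrable_add integrable_scaleR_right
    integrable_comp_fst[where F = "\<lambda>x. x"] integrable_comp_snd[where F = "\<lambda>x. x"]
    \<mu>.integrable_id \<nu>.integrable_id prob
  define g where "g s = (\<integral>p. f (sqrt (1 - s) *\<^sub>R fst p + sqrt s *\<^sub>R snd p) \<partial>(\<nu> \<Otimes>\<^sub>M \<mu>))" for s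

  have g0: "g 0 = (\<integral>x. f x \<partial>\<nu>)"
    using \<nu>\<mu>.integral_fst'[of "\<lambda>p. f (fst p)"] \<mu>.prob_space
    by (simp add: g_def integrable_f int)
  have g1: "g 1 = (\<integral>x. f x \<partial>\<mu>)"
    using \<nu>\<mu>.integral_fst'[of "\<lambda>p. f (snd p)"] \<nu>.prob_space
    by (simp add: g_def integrable_f int)

  have "continuous_on {0..1} g"
    unfolding continuous_on_sequentially comp_def
  proof (intro allI ballI impI, elim conjE)
    fix s :: "nat \<Rightarrow> real" and t assume s: "\<forall>n. s n \<in> {0..1}" "s \<longlonglongrightarrow> t"
    show "(\<lambda>n. g (s n)) \<longlonglongrightarrow> g t"
      unfolding g_def
    proof (rule integral_dominated_convergence[where w = "\<lambda>p. \<bar>f 0\<bar> + C * (norm (fst p) + norm (snd p))"])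
      show "integrable (\<nu> \<Otimes>\<^sub>M \<mu>) (\<lambda>p. \<bar>f 0\<bar> + C * (norm (fst p) + norm (snd p)))"
        by (intro Bochner_Integration.integrable_add integrable_mult_right integrable_const integrable_comp_fst
            integrable_comp_snd \<mu>.integrable_norm \<nu>.integrable_norm prob \<nu>\<mu>.P.integrable_const)
      show "AE p in \<nu> \<Otimes>\<^sub>M \<mu>. (\<lambda>n. f (sqrt (1 - s n) *\<^sub>R fst p + sqrt (s n) *\<^sub>R snd p))
          \<longlonglongrightarrow> f (sqrt (1 - t) *\<^sub>R fst p + sqrt t *\<^sub>R snd p)"
        by (intro AE_I2 continuous_on_tendsto_compose[OF cont_f] tendsto_intros s) simp_all
      show "AE p in \<nu> \<Otimes>\<^sub>M \<mu>. norm (f (sqrt (1 - s n) *\<^sub>R fst p + sqrt (s n) *\<^sub>R snd p))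
          \<le> \<bar>f 0\<bar> + C * (norm (fst p) + norm (snd p))" for n
      proof (rule AE_I2)
        fix p :: "'v \<times> 'v"
        have "s n \<in> {0..1}" using s(1) by blast
        then have "sqrt (1 - s n) * norm (fst p) \<le> norm (fst p)" "sqrt (s n) * norm (snd p) \<le> norm (snd p)"
          by (auto intro!: mult_left_le_one_le)
        then have "norm (sqrt (1 - s n) *\<^sub>R fst p + sqrt (s n) *\<^sub>R snd p) \<le> norm (fst p) + norm (snd p)"
          using norm_triangle_ineq[of "sqrt (1 - s n) *\<^sub>R fst p" "sqrt (s n) *\<^sub>R snd p"] \<open>s n \<in> {0..1}\<close> by simp
        from mult_left_mono[OF this C_nonneg]
        show "norm (f (sqrt (1 - s n) *\<^sub>R fst p + sqrt (s n) *\<^sub>R snd p)) \<le> \<bar>f 0\<bar> + C * (norm (fst p) + norm (snd p))"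
          using f_growth[of "sqrt (1 - s n) *\<^sub>R fst p + sqrt (s n) *\<^sub>R snd p"] by simp
      qed
    qed simp_all
  qed

  \<comment> \<open>The slack e absorbs the o(h) remainder and is sent to 0 at the very end.\<close>
  moreover have "\<exists>\<delta>>0. \<forall>h. 0 < h \<and> h < \<delta> \<longrightarrow> g (s + h) \<le> g s + (c / 2 + e) * h"
    if s: "0 \<le> s" "s < 1" and "e > 0" for s e
  proof -
    \<comment> \<open>The common base point of g (s + h) and g s: both are obtained from it by
      adding an independent increment of scale sqrt h, distributed as \<mu> and \<nu> respectively.
      It depends on h, hence the remainder estimate with a moving base point.\<close>
    define Z where "Z h p = sqrt (1 - s - h) *\<^sub>R fst p + sqrt s *\<^sub>R snd p" for h and p :: "'v \<times> 'v"
    have Z_lim: "((\<lambda>h. Z h p) \<longlongrightarrow> Z 0 p) (at_right 0)" for p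
      unfolding Z_def by (intro tendsto_intros)
    have Z_meas [measurable]: "Z h \<in> borel_measurable (\<nu> \<Otimes>\<^sub>M \<mu>)" for h
      unfolding Z_def by simp
    define E where "E \<rho> h = (\<integral>q. taylor_rem (Z h (fst q)) (sqrt h *\<^sub>R snd q) \<partial>((\<nu> \<Otimes>\<^sub>M \<mu>) \<Otimes>\<^sub>M \<rho>))"
      for \<rho> h

    have E_lim: "((\<lambda>h. E \<rho> h / h) \<longlongrightarrow> 0) (at_right 0)"
      and rem: "\<And>h. integrable (\<nu> \<Otimes>\<^sub>M \<mu>) (\<lambda>p. (\<integral>x. taylor_rem (Z h p) (sqrt h *\<^sub>R x) \<partial>\<rho>))"
        "\<And>h. (\<integral>p. (\<integral>x. taylor_rem (Z h p) (sqrt h *\<^sub>R x) \<partial>\<rho>) \<partial>(\<nu> \<Otimes>\<^sub>M \<mu>)) = E \<rho> h"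
      and avg: "\<And>h. integrable (\<nu> \<Otimes>\<^sub>M \<mu>) (\<lambda>p. (\<integral>x. f (Z h p + sqrt h *\<^sub>R x) \<partial>\<rho>))"
      if \<rho>: "gaussian_measure \<rho>" for \<rho>
    proof -
      interpret \<rho>: gaussian_measure \<rho> by fact
      interpret P\<rho>: pair_prob_space "\<nu> \<Otimes>\<^sub>M \<mu>" \<rho> ..
      have sq: "integrable ((\<nu> \<Otimes>\<^sub>M \<mu>) \<Otimes>\<^sub>M \<rho>) (\<lambda>q. (norm (snd q))\<^sup>2)"
        by (intro integrable_comp_snd \<rho>.integrable_norm_square prob \<rho>.prob_space_axioms)
      show "((\<lambda>h. E \<rho> h / h) \<longlongrightarrow> 0) (at_right 0)"
        unfolding E_def by (intro integral_taylor_rem_little_o sq Z_lim) simp_all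
      have r: "integrable ((\<nu> \<Otimes>\<^sub>M \<mu>) \<Otimes>\<^sub>M \<rho>) (\<lambda>q. taylor_rem (Z h (fst q)) (sqrt h *\<^sub>R snd q))" for h
        by (intro integrable_taylor_rem sq) simp_all
      show "integrable (\<nu> \<Otimes>\<^sub>M \<mu>) (\<lambda>p. (\<integral>x. taylor_rem (Z h p) (sqrt h *\<^sub>R x) \<partial>\<rho>))"
        "(\<integral>p. (\<integral>x. taylor_rem (Z h p) (sqrt h *\<^sub>R x) \<partial>\<rho>) \<partial>(\<nu> \<Otimes>\<^sub>M \<mu>)) = E \<rho> h" for h
        using P\<rho>.integrable_fst'[OF r[of h]] P\<rho>.integral_fst'[OF r[of h]] by (simp_all add: E_def)
      have "integrable ((\<nu> \<Otimes>\<^sub>M \<mu>) \<Otimes>\<^sub>M \<rho>) (\<lambda>q. f (Z h (fst q) + sqrt h *\<^sub>R snd q))" for h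
        unfolding Z_def
        by (intro integrable_f int integrable_comp_fst[where F = fst] integrable_comp_fst[where F = snd]
            \<rho>.integrable_id \<rho>.prob_space_axioms P\<rho>.P.prob_space_axioms)
      from P\<rho>.integrable_fst'[OF this]
      show "integrable (\<nu> \<Otimes>\<^sub>M \<mu>) (\<lambda>p. (\<integral>x. f (Z h p + sqrt h *\<^sub>R x) \<partial>\<rho>))" for h
        by simp
    qed

    have incr: "g (s + h) - g s \<le> c / 2 * h + (E \<mu> h - E \<nu> h)" if h: "0 < h" "h \<le> 1 - s" for h
    proof -
      have "g (s + h) = (\<integral>p. (\<integral>x. f (Z h p + sqrt h *\<^sub>R x) \<partial>\<mu>) \<partial>(\<nu> \<Otimes>\<^sub>M \<mu>))"
        using integral_split[OF \<mu> \<nu>, of s h "sqrt (1 - s - h)"] s h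
        by (simp add: g_def Z_def algebra_simps)
      moreover have "g s = (\<integral>p. (\<integral>x. f (Z h p + sqrt h *\<^sub>R x) \<partial>\<nu>) \<partial>(\<nu> \<Otimes>\<^sub>M \<mu>))"
      proof -
        \<comment> \<open>\<open>integral_split\<close> divides the second factor of the product.
          Swapping the factors makes that the \<nu> part, whose weight 1 - s is split into (1 - s -
          h) + h.\<close>
        have "g s = (\<integral>p. f (sqrt s *\<^sub>R fst p + sqrt (1 - s) *\<^sub>R snd p) \<partial>(\<mu> \<Otimes>\<^sub>M \<nu>))"
          unfolding g_def
          using \<mu>\<nu>.integral_product_swap[of "\<lambda>p. f (sqrt s *\<^sub>R fst p + sqrt (1 - s) *\<^sub>R snd p)"]
          by (simp add: case_prod_unfold add.commute)
        also have "\<dots> = (\<integral>p. f (sqrt s *\<^sub>R fst p + sqrt ((1 - s - h) + h) *\<^sub>R snd p) \<partial>(\<mu> \<Otimes>\<^sub>M \<nu>))"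
          by simp
        also have "\<dots> = (\<integral>p. (\<integral>x. f ((sqrt s *\<^sub>R fst p + sqrt (1 - s - h) *\<^sub>R snd p) + sqrt h *\<^sub>R x) \<partial>\<nu>) \<partial>(\<mu> \<Otimes>\<^sub>M \<nu>))"
          using s h by (intro integral_split[OF \<nu> \<mu>]) simp_all
        also have "\<dots> = (\<integral>p. (\<integral>x. f (Z h p + sqrt h *\<^sub>R x) \<partial>\<nu>) \<partial>(\<nu> \<Otimes>\<^sub>M \<mu>))"
          using \<nu>\<mu>.integral_product_swap[of "\<lambda>p. \<integral>x. f (Z h p + sqrt h *\<^sub>R x) \<partial>\<nu>"] avg[OF \<nu>, of h]
          by (simp add: case_prod_unfold add.commute Z_def)
        finally show ?thesis .
      qed
      ultimately have "g (s + h) - g s =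
          (\<integral>p. (\<integral>x. f (Z h p + sqrt h *\<^sub>R x) \<partial>\<mu>) - (\<integral>x. f (Z h p + sqrt h *\<^sub>R x) \<partial>\<nu>) \<partial>(\<nu> \<Otimes>\<^sub>M \<mu>))"
        using avg[OF \<mu>] avg[OF \<nu>] by simp
      also have "\<dots> \<le> (\<integral>p. c / 2 * h + ((\<integral>x. taylor_rem (Z h p) (sqrt h *\<^sub>R x) \<partial>\<mu>)
          - (\<integral>x. taylor_rem (Z h p) (sqrt h *\<^sub>R x) \<partial>\<nu>)) \<partial>(\<nu> \<Otimes>\<^sub>M \<mu>))"
      proof (rule integral_mono)
        fix p
        \<comment> \<open>In the difference of the two expansions the values f (Z h p) cancel, and
          the comparison hypothesis is used for the form \<open>D2f (Z h p)\<close>, separately at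
          each p.\<close>
        have "h / 2 * (\<integral>x. form_apply (D2f (Z h p)) x x \<partial>\<mu>) \<le>
            h / 2 * ((\<integral>x. form_apply (D2f (Z h p)) x x \<partial>\<nu>) + c)"
          using h by (intro mult_left_mono comparison) simp
        then show "(\<integral>x. f (Z h p + sqrt h *\<^sub>R x) \<partial>\<mu>) - (\<integral>x. f (Z h p + sqrt h *\<^sub>R x) \<partial>\<nu>) \<le>
            c / 2 * h + ((\<integral>x. taylor_rem (Z h p) (sqrt h *\<^sub>R x) \<partial>\<mu>)
              - (\<integral>x. taylor_rem (Z h p) (sqrt h *\<^sub>R x) \<partial>\<nu>))"
          using h by (simp add: gaussian_expansion[OF \<mu>] gaussian_expansion[OF \<nu>] algebra_simps)
      qed (intro Bochner_Integration.integrable_diff Bochner_Integration.integrable_add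
          avg[OF \<mu>] avg[OF \<nu>] rem(1)[OF \<mu>] rem(1)[OF \<nu>] \<nu>\<mu>.P.integrable_const)+
      also have "\<dots> = c / 2 * h + (E \<mu> h - E \<nu> h)"
        using rem[OF \<mu>] rem[OF \<nu>] \<nu>\<mu>.P.prob_space
        by (subst Bochner_Integration.integral_add) simp_all
      finally show ?thesis .
    qed

    have "((\<lambda>h. E \<mu> h / h - E \<nu> h / h) \<longlongrightarrow> 0 - 0) (at_right 0)"
      by (intro tendsto_diff E_lim \<mu> \<nu>)
    then have "\<forall>\<^sub>F h in at_right 0. E \<mu> h / h - E \<nu> h / h < e"
      using \<open>e > 0\<close> by (simp add: order_tendstoD)
    then obtain b where b: "b > 0" "\<And>h. 0 < h \<Longrightarrow> h < b \<Longrightarrow> E \<mu> h / h - E \<nu> h / h < e"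
      unfolding eventually_at_right_field by blast
    show ?thesis
    proof (intro exI[of _ "min b (1 - s)"] conjI allI impI)
      show "0 < min b (1 - s)" using b(1) s by simp
    next
      fix h assume h: "0 < h \<and> h < min b (1 - s)"
      have "E \<mu> h - E \<nu> h \<le> e * h"
        using b(2)[of h] h by (simp add: field_simps)
      then show "g (s + h) \<le> g s + (c / 2 + e) * h"
        using incr[of h] h by (simp add: algebra_simps)
    qed
  qed
  ultimately have "g 1 \<le> g 0 + (c / 2 + e)" if "e > 0" for e
    using that by (intro right_increments_le_imp_le) auto
  then have "g 1 \<le> (g 0 + c / 2) + e" if "e > 0" for e
    using that by (simp add: add.assoc)
  then show ?thesis
    unfolding g0[symmetric] g1[symmetric] by (rule field_le_epsilon)
qed

section \<open>From random variables to their laws\<close>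

lemma gaussian_measure_distr:
  assumes "prob_space M" "centered_gaussian M X"
  shows "gaussian_measure (distr M borel X)"
proof -
  interpret prob_space M by fact
  have X: "X \<in> borel_measurable M"
    and proj: "\<exists>\<sigma>\<ge>0. distr M borel (\<lambda>\<omega>. blinfun_apply l (X \<omega>)) = centered_normal \<sigma>" for l
    using assms(2) by (simp_all add: centered_gaussian_def)
  interpret D: prob_space "distr M borel X" by (rule prob_space_distr) (rule X)
  show ?thesis
  proof
    fix l :: "'b \<Rightarrow>\<^sub>L real"
    have "blinfun_apply l \<in> borel_measurable borel"
      by (intro borel_measurable_continuous_onI continuous_intros)
    then show "\<exists>\<sigma>\<ge>0. distr (distr M borel X) borel (blinfun_apply l) = centered_normal \<sigma>"
      using proj[of l] X by (simp add: distr_distr comp_def)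
  qed simp
qed

theorem theorem3:
  fixes M :: "'a measure"
    and \<phi> \<psi> :: "'a \<Rightarrow> 'v::{banach, second_countable_topology}"
    and f :: "'v \<Rightarrow> real"
    and Df :: "'v \<Rightarrow> ('v \<Rightarrow>\<^sub>L real)"
    and D2f :: "'v \<Rightarrow> 'v bilinear_form"
    and \<H> :: "'v bilinear_form set"
    and c :: real
  assumes "prob_space M"
    and "centered_gaussian M \<phi>"
    and "centered_gaussian M \<psi>"
    and "\<And>x. (f has_derivative blinfun_apply (Df x)) (at x)"
    and "\<And>x. (Df has_derivative blinfun_apply (D2f x)) (at x)"
    and "continuous_on UNIV D2f"
    and "bounded (range Df)"
    and "bounded (range D2f)"
    and "\<And>x. D2f x \<in> \<H>"
    and "\<And>H. H \<in> \<H> \<Longrightarrow>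
           (\<integral>\<omega>. form_apply H (\<phi> \<omega>) (\<phi> \<omega>) \<partial>M) \<le> (\<integral>\<omega>. form_apply H (\<psi> \<omega>) (\<psi> \<omega>) \<partial>M) + c"
  shows "(\<integral>\<omega>. f (\<phi> \<omega>) \<partial>M) \<le> (\<integral>\<omega>. f (\<psi> \<omega>) \<partial>M) + c / 2"
proof -
  obtain C where C: "\<And>x. norm (Df x) \<le> C"
    using assms(7) by (auto simp: bounded_iff)
  obtain B where B: "\<And>x. norm (D2f x) \<le> B"
    using assms(8) by (auto simp: bounded_iff)
  interpret bounded_C2 f Df D2f C B
    by (unfold_locales) (fact assms C B)+
  have meas: "\<phi> \<in> borel_measurable M" "\<psi> \<in> borel_measurable M"
    using assms(2,3) by (simp_all add: centered_gaussian_def)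
  have form: "(\<lambda>x. form_apply H x x) \<in> borel_measurable borel" for H :: "'v bilinear_form"
    by (intro borel_measurable_continuous_onI continuous_intros
        bounded_bilinear.continuous_on[OF bounded_bilinear_blinfun_apply])
  \<comment> \<open>All expectations depend on the two laws separately, and the interpolation uses
    independent copies of these laws rather than the joint law on \<open>M\<close>.\<close>
  have "(\<integral>x. f x \<partial>(distr M borel \<phi>)) \<le> (\<integral>x. f x \<partial>(distr M borel \<psi>)) + c / 2"
  proof (rule gaussian_comparison)
    show "gaussian_measure (distr M borel \<phi>)" "gaussian_measure (distr M borel \<psi>)"
      using assms(1-3) by (simp_all add: gaussian_measure_distr)
    show "(\<integral>x. form_apply (D2f z) x x \<partial>(distr M borel \<phi>)) \<le>
        (\<integral>x. form_apply (D2f z) x x \<partial>(distr M borel \<psi>)) + c" for z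
      using assms(10)[OF assms(9)[of z]] by (simp add: integral_distr meas form)
  qed
  then show ?thesis
    by (simp add: integral_distr meas)
qed

end
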